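(* Let $(X,\mathfrak S)$ be a hierarchically hyperbolic space with metric $d$. There exists a metric $\sigma$ on $X$ such that $(X,\sigma)$ is coarsely injective and quasi-isometric to $(X,d)$. Moreover, $\sigma$ is invariant with respect to the automorphism group of $(X,\mathfrak S)$.
   Context: Coarsely injective: a metric space $(X,\sigma)$ is coarsely injective if there is a constant $\delta\ge 0$ such that for any family $\{B(x_i,r_i):i\in I\}$ of balls with $\sigma(x_i,x_j)\le r_i+r_j$ for all $i,j\in I$, the $\delta$-neighbourhoods of those balls have nonempty total intersection. "Quasi-isometric" here means that the identity map $(X,\sigma)\to(X,d)$ is a quasi-isometry. Hierarchically hyperbolic space (HHS). A quasigeodesic metric space $(X,d)$ is an HHS, written $(X,\mathfrak S)$, if there are a constant $E\ge 1$, a set $\mathfrak S$ (of "domains"), and for each $U\in\mathfrak S$ a geodesic $E$-hyperbolic space $\mathcal CU$, with the following. Write $d_U(x,y)=d_{\mathcal CU}(\pi_U(x),\pi_U(y))$ for $x,y\in X$, and similarly for subsets of $X$ or $\mathcal CU$; distances between sets are infima. (1) Projections: for each $U$ there is an $E$-coarsely onto, $(E,E)$-coarsely Lipschitz map $\pi_U:X\to\mathcal CU$. (2) Nesting: $\mathfrak S$ has a partial order $\sqsubseteq$ with a unique maximal element (if $\mathfrak S\ne\emptyset$). If $U\sqsubsetneq V$ there are a nonempty set $\rho^U_V\subset\mathcal CV$ of diameter at most $E$ and a map $\rho^V_U:\mathcal CV\to\mathcal CU$. (3) Orthogonality: there is a symmetric, anti-reflexive relation $\bot$ on $\mathfrak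 S$; if $U\sqsubseteq V$ and $V\bot W$ then $U\bot W$; orthogonal domains are not $\sqsubseteq$-comparable; for each $T\in\mathfrak S$ and $U\sqsubseteq T$ such that some $V\sqsubseteq T$ has $V\bot U$, there is $W\sqsubsetneq T$ such that every $V\sqsubseteq T$ with $V\bot U$ satisfies $V\sqsubseteq W$. (4) Transversality and consistency: $U,V$ are transverse, $U\pitchfork V$, if they are neither orthogonal nor $\sqsubseteq$-comparable; then there are nonempty sets $\rho^U_V\subset\mathcal CV$, $\rho^V_U\subset\mathcal CU$ of diameter at most $E$ with $\min\{d_U(x,\rho^V_U),d_V(x,\rho^U_V)\}\le E$ for all $x\in X$. If $U\sqsubsetneq V$ then $\min\{d_V(x,\rho^U_V),\operatorname{diam}(\{\pi_U(x)\}\cup\rho^V_U(\pi_V(x)))\}\le E$ for all $x\in X$. If $U\sqsubseteq V$, then $d_W(\rho^U_W,\rho^V_W)\le E$ whenever $V\sqsubsetneq W$, or $V\pitchfork W$ and $W\not\perp U$. (5) Finite complexity: the cardinalities of sets of pairwise $\sqsubseteq$-comparable domains are at most $E$. (6) Large links: for $W\in\mathfrak S$ and $x,x'\in X$, put $N=E\,d_W(x,x')+E$. There are $T_1,\dots,T_{\lfloor N\rfloor}\sqsubsetneq W$ such that every $T\sqsubsetneq W$ satisfies $T\sqsubseteq T_i$ for some $i$ or $d_T(x,x')<E$; and $d_W(x,\rho^{T_i}_W)\le N$ for all $i$. (7) Bounded geodesic image: if $U\sqsubsetneq V$ and $\gamma\subset\mathcal CV$ is a geodesic with $d_V(\gamma,\rho^U_V)>E$,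 then $\operatorname{diam}\rho^V_U(\gamma)\le E$. (8) Partial realisation: if $\{U_i\}$ is a set of pairwise orthogonal domains and $p_i\in\mathcal CU_i$, there is $x\in X$ with $d_{U_i}(x,p_i)\le E$ for all $i$ and $d_V(x,\rho^{U_i}_V)\le E$ whenever $U_i\sqsubsetneq V$ or $U_i\pitchfork V$. (9) Uniqueness: for each $\kappa\ge0$ there is $\theta(\kappa)$ such that if $d(x,y)\ge\theta(\kappa)$ then $d_V(x,y)\ge\kappa$ for some $V\in\mathfrak S$. Automorphisms. An automorphism of $(X,\mathfrak S)$ is an isometry $g$ of $(X,d)$ together with a bijection $U\mapsto gU$ of $\mathfrak S$ preserving $\sqsubseteq$ and $\bot$ and isometries $g:\mathcal CU\to\mathcal C(gU)$ such that $g\pi_U(x)=\pi_{gU}(gx)$ for all $x\in X$, $U\in\mathfrak S$, and $g\rho^U_V=\rho^{gU}_{gV}$ whenever $U\sqsubsetneq V$ or $U\pitchfork V$. These form the automorphism group of $(X,\mathfrak S)$. Invariance means $\sigma(gx,gy)=\sigma(x,y)$ for all automorphisms $g$ and all $x,y\in X$. *)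

theory Defs
  imports "HOL-Analysis.Analysis"
begin

text \<open>
  The library has no distance between sets, extended diameter or neighbourhood for a metric given
  on a carrier set. \<open>set_distance\<close> is only meaningful for two nonempty sets. The diameter is
  extended-valued, so that a diameter bound does imply boundedness.
\<close>

definition set_distance :: "('a \<Rightarrow> 'a \<Rightarrow> real) \<Rightarrow> 'a set \<Rightarrow> 'a set \<Rightarrow> real" where
  "set_distance d A B = (INF (a, b)\<in>A \<times> B. d a b)"

definition ediameter :: "('a \<Rightarrow> 'a \<Rightarrow> real) \<Rightarrow> 'a set \<Rightarrow> ennreal" where
  "ediameter d A = (SUP (a, b)\<in>A \<times> A. ennreal (d a b))"

definition neighbourhood :: "'a set \<Rightarrow> ('a \<Rightarrow> 'a \<Rightarrow> real) \<Rightarrow> real \<Rightarrow> 'a set \<Rightarrow> 'a set" where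
  "neighbourhood M d \<delta> A = {y \<in> M. \<exists>z\<in>A. d z y \<le> \<delta>}"

lemma ediameter_le_iff:
  assumes "0 \<le> r"
  shows "ediameter d A \<le> ennreal r \<longleftrightarrow> (\<forall>a\<in>A. \<forall>b\<in>A. d a b \<le> r)"
  using assms by (auto simp: ediameter_def SUP_le_iff ennreal_le_iff)

text \<open>
  A family of balls is given by the set of its centre-radius pairs. The balls are closed; the
  condition for a pair with itself makes every radius nonnegative. Intersecting with the carrier
  gives the intersection of the empty family its usual meaning.
\<close>

definition coarsely_injective :: "'a set \<Rightarrow> ('a \<Rightarrow> 'a \<Rightarrow> real) \<Rightarrow> bool" where
  "coarsely_injective M d \<longleftrightarrow> Metric_space M d \<and>
    (\<exists>\<delta>\<ge>0. \<forall>F \<subseteq> M \<times> UNIV.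
      (\<forall>(x, r)\<in>F. \<forall>(y, s)\<in>F. d x y \<le> r + s) \<longrightarrow>
      M \<inter> (\<Inter>(x, r)\<in>F. neighbourhood M d \<delta> (Metric_space.mcball M d x r)) \<noteq> {})"

definition quasi_isometric_embedding ::
  "real \<Rightarrow> real \<Rightarrow> 'a set \<Rightarrow> ('a \<Rightarrow> 'a \<Rightarrow> real) \<Rightarrow> 'b set \<Rightarrow> ('b \<Rightarrow> 'b \<Rightarrow> real) \<Rightarrow> ('a \<Rightarrow> 'b) \<Rightarrow> bool" where
  "quasi_isometric_embedding K L M d M' d' f \<longleftrightarrow> f \<in> M \<rightarrow> M' \<and>
    (\<forall>x\<in>M. \<forall>y\<in>M. d x y / K - L \<le> d' (f x) (f y) \<and> d' (f x) (f y) \<le> K * d x y + L)"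

definition quasi_isometry ::
  "'a set \<Rightarrow> ('a \<Rightarrow> 'a \<Rightarrow> real) \<Rightarrow> 'b set \<Rightarrow> ('b \<Rightarrow> 'b \<Rightarrow> real) \<Rightarrow> ('a \<Rightarrow> 'b) \<Rightarrow> bool" where
  "quasi_isometry M d M' d' f \<longleftrightarrow>
    (\<exists>K\<ge>1. \<exists>L\<ge>0. quasi_isometric_embedding K L M d M' d' f \<and>
      (\<forall>y\<in>M'. \<exists>x\<in>M. d' (f x) y \<le> L))"

definition quasigeodesic_space :: "'a set \<Rightarrow> ('a \<Rightarrow> 'a \<Rightarrow> real) \<Rightarrow> bool" where
  "quasigeodesic_space M d \<longleftrightarrow> Metric_space M d \<and>
    (\<exists>K\<ge>1. \<exists>L\<ge>0. \<forall>x\<in>M. \<forall>y\<in>M. \<exists>T\<ge>0. \<exists>q::real \<Rightarrow> 'a.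
      q 0 = x \<and> q T = y \<and> quasi_isometric_embedding K L {0..T} dist M d q)"

definition geodesic_segment :: "'a set \<Rightarrow> ('a \<Rightarrow> 'a \<Rightarrow> real) \<Rightarrow> 'a \<Rightarrow> 'a \<Rightarrow> 'a set \<Rightarrow> bool" where
  "geodesic_segment M d x y G \<longleftrightarrow>
    (\<exists>\<gamma>::real \<Rightarrow> 'a. \<gamma> \<in> {0..d x y} \<rightarrow> M \<and> \<gamma> 0 = x \<and> \<gamma> (d x y) = y \<and>
      (\<forall>s\<in>{0..d x y}. \<forall>t\<in>{0..d x y}. d (\<gamma> s) (\<gamma> t) = \<bar>s - t\<bar>) \<and>
      G = \<gamma> ` {0..d x y})"

definition geodesic_space :: "'a set \<Rightarrow> ('a \<Rightarrow> 'a \<Rightarrow> real) \<Rightarrow> bool" where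
  "geodesic_space M d \<longleftrightarrow> Metric_space M d \<and>
    (\<forall>x\<in>M. \<forall>y\<in>M. \<exists>G. geodesic_segment M d x y G)"

text \<open>Hyperbolicity of a geodesic space is expressed by slimness of geodesic triangles.\<close>

definition hyperbolic_space :: "real \<Rightarrow> 'a set \<Rightarrow> ('a \<Rightarrow> 'a \<Rightarrow> real) \<Rightarrow> bool" where
  "hyperbolic_space \<delta> M d \<longleftrightarrow> geodesic_space M d \<and>
    (\<forall>x\<in>M. \<forall>y\<in>M. \<forall>z\<in>M. \<forall>P Q R.
      geodesic_segment M d x y P \<longrightarrow> geodesic_segment M d y z Q \<longrightarrow> geodesic_segment M d x z R \<longrightarrow>
      P \<subseteq> neighbourhood M d \<delta> (Q \<union> R))"

definition isometry_onto ::
  "'a set \<Rightarrow> ('a \<Rightarrow> 'a \<Rightarrow> real) \<Rightarrow> 'b set \<Rightarrow> ('b \<Rightarrow> 'b \<Rightarrow> real) \<Rightarrow> ('a \<Rightarrow> 'b) \<Rightarrow> bool" where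
  "isometry_onto M d M' d' f \<longleftrightarrow> f ` M = M' \<and> (\<forall>x\<in>M. \<forall>y\<in>M. d' (f x) (f y) = d x y)"

definition properly_nested :: "'u rel \<Rightarrow> 'u \<Rightarrow> 'u \<Rightarrow> bool" where
  "properly_nested nest U V \<longleftrightarrow> (U, V) \<in> nest \<and> U \<noteq> V"

definition transverse :: "'u set \<Rightarrow> 'u rel \<Rightarrow> 'u rel \<Rightarrow> 'u \<Rightarrow> 'u \<Rightarrow> bool" where
  "transverse \<SS> nest orth U V \<longleftrightarrow>
    U \<in> \<SS> \<and> V \<in> \<SS> \<and> (U, V) \<notin> orth \<and> (U, V) \<notin> nest \<and> (V, U) \<notin> nest"

text \<open>
  The spaces \<open>C U\<close> are subsets of one type \<open>'c\<close>, with separate metrics \<open>dC U\<close>; this is no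
  restriction, since \<open>'c\<close> may contain their disjoint union. The set \<open>\<rho> U V\<close>, a subset of \<open>C V\<close>,
  is $\rho^U_V$ for \<open>U\<close> properly nested in \<open>V\<close> or transverse to \<open>V\<close>; the map
  \<open>\<rho>map V U\<close>, from \<open>C V\<close> to \<open>C U\<close>, is $\rho^V_U$ for \<open>U\<close> properly nested in \<open>V\<close>.
\<close>

locale hierarchically_hyperbolic_space = Metric_space X d
  for X :: "'x set" and d :: "'x \<Rightarrow> 'x \<Rightarrow> real" +
  fixes E :: real
    and \<SS> :: "'u set"
    and C :: "'u \<Rightarrow> 'c set"
    and dC :: "'u \<Rightarrow> 'c \<Rightarrow> 'c \<Rightarrow> real"
    and \<pi> :: "'u \<Rightarrow> 'x \<Rightarrow> 'c"
    and nest :: "'u rel"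
    and orth :: "'u rel"
    and \<rho> :: "'u \<Rightarrow> 'u \<Rightarrow> 'c set"
    and \<rho>map :: "'u \<Rightarrow> 'u \<Rightarrow> 'c \<Rightarrow> 'c"
  assumes quasigeodesic: "quasigeodesic_space X d"
    and E_ge_1: "E \<ge> 1"
    and hyperbolic: "\<And>U. U \<in> \<SS> \<Longrightarrow> hyperbolic_space E (C U) (dC U)"
    and proj_in: "\<And>U. U \<in> \<SS> \<Longrightarrow> \<pi> U \<in> X \<rightarrow> C U"
    and proj_coarsely_onto: "\<And>U p. U \<in> \<SS> \<Longrightarrow> p \<in> C U \<Longrightarrow> \<exists>x\<in>X. dC U (\<pi> U x) p \<le> E"
    and proj_coarsely_Lipschitz:
      "\<And>U x y. U \<in> \<SS> \<Longrightarrow> x \<in> X \<Longrightarrow> y \<in> X \<Longrightarrow> dC U (\<pi> U x) (\<pi> U y) \<le> E * d x y + E"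
    and nest_partial_order: "partial_order_on \<SS> nest"
    and nest_unique_maximal:
      "\<SS> \<noteq> {} \<Longrightarrow> \<exists>!M. M \<in> \<SS> \<and> (\<forall>U\<in>\<SS>. (M, U) \<in> nest \<longrightarrow> U = M)"
    and nest_rho: "\<And>U V. properly_nested nest U V \<Longrightarrow>
      \<rho> U V \<noteq> {} \<and> \<rho> U V \<subseteq> C V \<and> ediameter (dC V) (\<rho> U V) \<le> ennreal E"
    and nest_rho_map: "\<And>U V. properly_nested nest U V \<Longrightarrow> \<rho>map V U \<in> C V \<rightarrow> C U"
    and orth_domains: "orth \<subseteq> \<SS> \<times> \<SS>"
    and orth_sym: "sym orth"
    and orth_irrefl: "irrefl orth"
    and orth_nest: "\<And>U V W. (U, V) \<in> nest \<Longrightarrow> (V, W) \<in> orth \<Longrightarrow> (U, W) \<in> orth"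
    and orth_not_comparable:
      "\<And>U V. (U, V) \<in> orth \<Longrightarrow> (U, V) \<notin> nest \<and> (V, U) \<notin> nest"
    and orth_container: "\<And>T U. (U, T) \<in> nest \<Longrightarrow> (\<exists>V. (V, T) \<in> nest \<and> (V, U) \<in> orth) \<Longrightarrow>
      \<exists>W. properly_nested nest W T \<and>
        (\<forall>V. (V, T) \<in> nest \<and> (V, U) \<in> orth \<longrightarrow> (V, W) \<in> nest)"
    and transverse_rho: "\<And>U V. transverse \<SS> nest orth U V \<Longrightarrow>
      \<rho> U V \<noteq> {} \<and> \<rho> U V \<subseteq> C V \<and> ediameter (dC V) (\<rho> U V) \<le> ennreal E"
    and transverse_consistency: "\<And>U V x. transverse \<SS> nest orth U V \<Longrightarrow> x \<in> X \<Longrightarrow>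
      min (set_distance (dC U) {\<pi> U x} (\<rho> V U)) (set_distance (dC V) {\<pi> V x} (\<rho> U V)) \<le> E"
    and nest_consistency: "\<And>U V x. properly_nested nest U V \<Longrightarrow> x \<in> X \<Longrightarrow>
      min (ennreal (set_distance (dC V) {\<pi> V x} (\<rho> U V)))
          (ediameter (dC U) ({\<pi> U x} \<union> {\<rho>map V U (\<pi> V x)})) \<le> ennreal E"
    and rho_consistency: "\<And>U V W. (U, V) \<in> nest \<Longrightarrow>
      properly_nested nest V W \<or> (transverse \<SS> nest orth V W \<and> (W, U) \<notin> orth) \<Longrightarrow>
      set_distance (dC W) (\<rho> U W) (\<rho> V W) \<le> E"
    and finite_complexity: "\<And>\<C>. \<C> \<subseteq> \<SS> \<Longrightarrow> pairwise (\<lambda>U V. (U, V) \<in> nest \<or> (V, U) \<in> nest) \<C> \<Longrightarrow>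
      finite \<C> \<and> real (card \<C>) \<le> E"
    \<comment> \<open>\<open>\<T>\<close> is the set of the \<open>T\<^sub>i\<close>; there are at most (not exactly)
      \<open>\<lfloor>N\<rfloor>\<close> of them, so that it may be empty when \<open>W\<close> is minimal\<close>
    and large_links: "\<And>W x x' N. W \<in> \<SS> \<Longrightarrow> x \<in> X \<Longrightarrow> x' \<in> X \<Longrightarrow>
      N = E * dC W (\<pi> W x) (\<pi> W x') + E \<Longrightarrow>
      \<exists>\<T>. finite \<T> \<and> int (card \<T>) \<le> \<lfloor>N\<rfloor> \<and> (\<forall>T\<in>\<T>. properly_nested nest T W) \<and>
        (\<forall>T. properly_nested nest T W \<longrightarrow>
          (\<exists>T'\<in>\<T>. (T, T') \<in> nest) \<or> dC T (\<pi> T x) (\<pi> T x') < E) \<and>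
        (\<forall>T\<in>\<T>. set_distance (dC W) {\<pi> W x} (\<rho> T W) \<le> N)"
    and bounded_geodesic_image: "\<And>U V p q G. properly_nested nest U V \<Longrightarrow>
      p \<in> C V \<Longrightarrow> q \<in> C V \<Longrightarrow> geodesic_segment (C V) (dC V) p q G \<Longrightarrow>
      set_distance (dC V) G (\<rho> U V) > E \<Longrightarrow> ediameter (dC U) (\<rho>map V U ` G) \<le> ennreal E"
    and partial_realisation: "\<And>\<U> p. \<U> \<subseteq> \<SS> \<Longrightarrow> pairwise (\<lambda>U V. (U, V) \<in> orth) \<U> \<Longrightarrow>
      (\<And>U. U \<in> \<U> \<Longrightarrow> p U \<in> C U) \<Longrightarrow>
      \<exists>x\<in>X. \<forall>U\<in>\<U>. dC U (\<pi> U x) (p U) \<le> E \<and>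
        (\<forall>V\<in>\<SS>. properly_nested nest U V \<or> transverse \<SS> nest orth U V \<longrightarrow>
          set_distance (dC V) {\<pi> V x} (\<rho> U V) \<le> E)"
    and uniqueness: "\<And>\<kappa>. \<kappa> \<ge> 0 \<Longrightarrow>
      \<exists>\<theta>. \<forall>x\<in>X. \<forall>y\<in>X. d x y \<ge> \<theta> \<longrightarrow> (\<exists>V\<in>\<SS>. dC V (\<pi> V x) (\<pi> V y) \<ge> \<kappa>)"

text \<open>
  An automorphism consists of \<open>g\<close> on \<open>X\<close>, \<open>gS\<close> on the domains and \<open>gC U\<close> from \<open>C U\<close> to
  \<open>C (gS U)\<close>. Equivariance is required for the sets \<open>\<rho>\<close> only, not for the maps between
  hyperbolic spaces.
\<close>

definition hhs_automorphism ::
  "'x set \<Rightarrow> ('x \<Rightarrow> 'x \<Rightarrow> real) \<Rightarrow> 'u set \<Rightarrow> ('u \<Rightarrow> 'c set) \<Rightarrow> ('u \<Rightarrow> 'c \<Rightarrow> 'c \<Rightarrow> real) \<Rightarrow>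
    ('u \<Rightarrow> 'x \<Rightarrow> 'c) \<Rightarrow> 'u rel \<Rightarrow> 'u rel \<Rightarrow> ('u \<Rightarrow> 'u \<Rightarrow> 'c set) \<Rightarrow>
    ('x \<Rightarrow> 'x) \<Rightarrow> ('u \<Rightarrow> 'u) \<Rightarrow> ('u \<Rightarrow> 'c \<Rightarrow> 'c) \<Rightarrow> bool" where
  "hhs_automorphism X d \<SS> C dC \<pi> nest orth \<rho> g gS gC \<longleftrightarrow>
    isometry_onto X d X d g \<and>
    bij_betw gS \<SS> \<SS> \<and>
    (\<forall>U\<in>\<SS>. \<forall>V\<in>\<SS>. ((gS U, gS V) \<in> nest \<longleftrightarrow> (U, V) \<in> nest) \<and>
                ((gS U, gS V) \<in> orth \<longleftrightarrow> (U, V) \<in> orth)) \<and>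
    (\<forall>U\<in>\<SS>. isometry_onto (C U) (dC U) (C (gS U)) (dC (gS U)) (gC U)) \<and>
    (\<forall>U\<in>\<SS>. \<forall>x\<in>X. gC U (\<pi> U x) = \<pi> (gS U) (g x)) \<and>
    (\<forall>U\<in>\<SS>. \<forall>V\<in>\<SS>. properly_nested nest U V \<or> transverse \<SS> nest orth U V \<longrightarrow>
      gC V ` \<rho> U V = \<rho> (gS U) (gS V))"

end

theory Submission
  imports Defs
begin

text \<open>
  A wall consists of a sublevel and a superlevel set, a fixed amount apart, of a Gromov product on
  one of the hyperbolic spaces, pulled back to \<open>X\<close>. Two points are at \<open>\<sigma>\<close>-distance about \<open>n\<close> if the longest
  nested chain of walls between them has length \<open>n\<close>. If the last walls of chains issuing from \<open>x\<close>
  and from \<open>y\<close> cover \<open>X\<close>, the chains can be glued; hence the half-spaces cut off by chains longer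
  than the radii meet in pairs when \<open>\<sigma> x y \<le> r + s\<close>. A point close to all these half-spaces then comes
  from a coarse Helly theorem for arbitrary families of pairwise intersecting subsets of \<open>X\<close>:
  in each hyperbolic space take the farthest of the projections to the geodesic hulls of the members
  from a base point; these projections form a consistent tuple, and consistent tuples are realised.
  For two points this shows that \<open>\<sigma>\<close> is roughly geodesic, so that \<open>d\<close> is bounded by \<open>\<sigma>\<close> linearly as
  soon as it is bounded by some function of \<open>\<sigma>\<close>, which is the uniqueness axiom.
\<close>

section \<open>Gromov products and coarse hulls\<close>

text \<open>Invariance excludes choices in the definition of \<sigma>: walls are taken over all
  domains, all pairs of end points and all levels, with one fixed gap. No quasiconvexity of
  \<sigma>-balls is available, so the Helly theorem takes arbitrary sets and promises only nearness
  to their hulls in every domain. This suffices because an upper bound on a Gromov product passes to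
  hulls with loss \<open>D / 2\<close>: a point near the hulls of a subset of \<open>A\<close>
  cannot cross the gap to \<open>B\<close>. The tuple of farthest projections is consistent because
  each coordinate plays two roles. It is near the hulls of all members, and it is a coarse
  projection to one of them, through which geodesics from the base point to that member nearly pass.
  So the member chosen in one domain can be tested in another. The realisation axiom prescribes
  coordinates only on pairwise orthogonal domains; a whole tuple is reached by improving such a
  family under a measure that finite complexity bounds.\<close>

definition gromov_product :: "('a \<Rightarrow> 'a \<Rightarrow> real) \<Rightarrow> 'a \<Rightarrow> 'a \<Rightarrow> 'a \<Rightarrow> real" where
  "gromov_product d s x y = (d s x + d s y - d x y) / 2"

lemma gromov_product_double: "2 * gromov_product d s x y = d s x + d s y - d x y"
  by (simp add: gromov_product_def)

definition geodesic_hull :: "'a set \<Rightarrow> ('a \<Rightarrow> 'a \<Rightarrow> real) \<Rightarrow> 'a set \<Rightarrow> 'a set" where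
  "geodesic_hull M d A = {c \<in> M. \<exists>a\<in>A. \<exists>b\<in>A. d a c + d c b = d a b}"

locale gromov_hyperbolic = Metric_space M d
  for M :: "'a set" and d :: "'a \<Rightarrow> 'a \<Rightarrow> real" +
  fixes D :: real
  assumes D_pos: "0 < D"
    and four_point: "\<lbrakk>x \<in> M; y \<in> M; z \<in> M; w \<in> M\<rbrakk> \<Longrightarrow>
      d x y + d z w \<le> d x z + d y w + D \<or> d x y + d z w \<le> d x w + d y z + D"
    and between_exists: "\<lbrakk>x \<in> M; y \<in> M; 0 \<le> t; t \<le> d x y\<rbrakk> \<Longrightarrow>
      \<exists>m\<in>M. d x m = t \<and> d m y = d x y - t"
begin

abbreviation gp where "gp \<equiv> gromov_product d"
abbreviation ghull where "ghull \<equiv> geodesic_hull M d"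

lemma gp_le_dist:
  assumes "s \<in> M" "x \<in> M" "y \<in> M"
  shows "gp s x y \<le> d s x" "gp s x y \<le> d s y" "0 \<le> gp s x y"
proof -
  show "gp s x y \<le> d s x" "gp s x y \<le> d s y" "0 \<le> gp s x y"
    using triangle[OF assms] triangle[OF assms(1,3,2)] triangle[OF assms(2,1,3)] commute[of x y] commute[of x s]
      gromov_product_double[of d s x y] by linarith+
qed

lemma gp_commute: "gp s x y = gp s y x"
  using gromov_product_double[of d s x y] gromov_product_double[of d s y x] commute[of x y] by linarith

lemma gp_lipschitz:
  assumes "s \<in> M" "x \<in> M" "y \<in> M" "z \<in> M"
  shows "gp s x y \<le> gp s x z + d y z"
  using triangle[OF assms(1,4,3)] triangle[OF assms(2,3,4)] commute[of y z]
  using gromov_product_double by (smt (verit))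

lemma gp_min:
  assumes "s \<in> M" "x \<in> M" "y \<in> M" "z \<in> M"
  shows "min (gp s x y) (gp s y z) - D / 2 \<le> gp s x z"
  using four_point[OF assms(2,4,3,1)] commute[of y s] commute[of z s] commute[of z y] commute[of x s]
  using gromov_product_double[of d s x y] gromov_product_double[of d s x z] gromov_product_double[of d s y z]
  by (smt (verit) field_sum_of_halves)

lemma hull_superset: "A \<subseteq> M \<Longrightarrow> A \<subseteq> ghull A"
  by (force simp: geodesic_hull_def)

lemma hull_subset: "ghull A \<subseteq> M"
  by (auto simp: geodesic_hull_def)

text \<open>Up to \<open>D\<close>, a Gromov product bounds the distance to some geodesic. The
  witness is the corner of the comparison tripod, at distance \<open>gp a e y\<close> from
  \<open>a\<close>.\<close>

lemma exists_between_near: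
  assumes e: "e \<in> M" "a \<in> M" "y \<in> M"
  obtains q where "q \<in> M" "d a q + d q y = d a y" "d e q \<le> gp e a y + D"
proof -
  have "gp a e y \<le> d a y" "0 \<le> gp a e y"
    using gp_le_dist[of a e y] e by auto
  then obtain q where q: "q \<in> M" "d a q = gp a e y" "d q y = d a y - gp a e y"
    using between_exists[OF e(2,3)] by blast
  have "d e q + d a y \<le> d e a + d q y + D \<or> d e q + d a y \<le> d e y + d q a + D"
    using four_point[of e q a y] e q by blast
  then have "d e q \<le> gp e a y + D"
    using q(2,3) commute[of a e] commute[of a q] gromov_product_double by (smt (verit))
  with q that show ?thesis
    by force
qed

text \<open>Since \<open>gp e p y = 0\<close>, every \<open>c\<close> in \<open>A\<close> has
  \<open>gp e p c\<close> or \<open>gp e c y\<close> at most \<open>D / 2\<close>. For the ends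
  \<open>a\<close>, \<open>b\<close> of the geodesic through \<open>p\<close>, one small product
  with \<open>y\<close> puts \<open>e\<close> near a geodesic from that end to \<open>y\<close>; two
  small products with \<open>p\<close> put \<open>e\<close> within \<open>D\<close> of
  \<open>p\<close>, itself a point of the hull.\<close>

lemma hull_quasiconvex:
  assumes A: "A \<subseteq> M" and p: "p \<in> ghull A" and y: "y \<in> A" and e: "e \<in> M" "d p e + d e y = d p y"
  obtains q where "q \<in> ghull A" "d e q \<le> 3 * D / 2"
proof -
  obtain a b where ab: "a \<in> A" "b \<in> A" "d a p + d p b = d a b" and pM: "p \<in> M"
    using p by (auto simp: geodesic_hull_def)
  have M: "a \<in> M" "b \<in> M" "y \<in> M"
    using ab y A by auto
  note result = that
  have near: thesis if c: "c \<in> A" "gp e c y \<le> D / 2" for c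
  proof -
    obtain q where q: "q \<in> M" "d c q + d q y = d c y" "d e q \<le> gp e c y + D"
      using exists_between_near[of e c y] e M c A by auto
    then have "q \<in> ghull A"
      using c y by (auto simp: geodesic_hull_def)
    with result[of q] q(3) c(2) show thesis
      by linarith
  qed
  have py: "gp e p y = 0"
    using e(2) commute[of p e] gromov_product_double by (smt (verit))
  have dich: "gp e c y \<le> D / 2 \<or> gp e p c \<le> D / 2" if "c \<in> A" for c
    using gp_min[of e p c y] e M pM that A py by fastforce
  show thesis
  proof (cases "gp e a y \<le> D / 2 \<or> gp e b y \<le> D / 2")
    case True
    then show thesis using near ab by blast
  next
    case False
    then have "gp e p a \<le> D / 2" "gp e p b \<le> D / 2"
      using dich ab by auto
    then have "d e p \<le> D"
      using ab(3) triangle[of a e b] M e commute[of p a] commute[of a e]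
      gromov_product_double[of d e p a] gromov_product_double[of d e p b] commute[of e p] commute[of b p] by (smt (verit) field_sum_of_halves)
    with result[OF p] D_pos show thesis
      by simp
  qed
qed

text \<open>The slack \<open>D\<close> in minimality absorbs that infima of distances need not be attained.\<close>

definition coarse_projection :: "'a set \<Rightarrow> 'a \<Rightarrow> 'a \<Rightarrow> bool" where
  "coarse_projection A x p \<longleftrightarrow> p \<in> ghull A \<and> (\<forall>q\<in>ghull A. d x p \<le> d x q + D)"

text \<open>Geodesics from \<open>x\<close> to \<open>A\<close> nearly pass through
  \<open>p\<close>: the point \<open>e\<close> between \<open>p\<close> and \<open>y\<close> at
  distance \<open>gp p x y\<close> from \<open>p\<close> is near the hull, yet closer to
  \<open>x\<close> than \<open>p\<close> by about that product, which near-minimality of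
  \<open>p\<close> therefore bounds.\<close>

lemma coarse_projection_between:
  assumes A: "A \<subseteq> M" and x: "x \<in> M" and p: "coarse_projection A x p" and y: "y \<in> A"
  shows "d x p + d p y \<le> d x y + 7 * D"
proof -
  have pM: "p \<in> M" and yM: "y \<in> M" and ph: "p \<in> ghull A"
    using p y A hull_subset by (auto simp: coarse_projection_def)
  have "0 \<le> gp p x y" "gp p x y \<le> d p y"
    using gp_le_dist[of p x y] pM yM x by auto
  then obtain e where e: "e \<in> M" "d p e = gp p x y" "d e y = d p y - gp p x y"
    using between_exists[OF pM yM] by blast
  obtain q where q: "q \<in> ghull A" "d e q \<le> 3 * D / 2"
    using hull_quasiconvex[OF A ph y e(1)] e by auto
  have "d x e + d p y \<le> d x p + d e y + D \<or> d x e + d p y \<le> d x y + d e p + D"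
    using four_point[of x e p y] x e pM yM by blast
  then have "d x e \<le> d x p - gp p x y + D"
    using e(2,3) commute[of e p] commute[of p x] gromov_product_double by (smt (verit))
  moreover have "d x p \<le> d x q + D" "d x q \<le> d x e + d e q"
    using p q x e hull_subset[of A] triangle[of x e q] by (auto simp: coarse_projection_def)
  ultimately have "gp p x y \<le> 7 * D / 2"
    using q(2) by linarith
  then show ?thesis
    using commute[of p x] gromov_product_double[of d p x y] by linarith
qed

text \<open>A point between \<open>a\<close> and \<open>b\<close> lies, up to \<open>D\<close>,
  between \<open>s\<close> and one of them, and moving back towards \<open>s\<close> does not
  increase the product with \<open>x\<close>.\<close>

lemma gp_hull_le:
  assumes A: "A \<subseteq> M" and s: "s \<in> M" "x \<in> M" and t: "\<And>a. a \<in> A \<Longrightarrow> gp s a x \<le> t" and c: "c \<in> ghull A"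
  shows "gp s c x \<le> t + D / 2"
proof -
  obtain a b where ab: "a \<in> A" "b \<in> A" "d a c + d c b = d a b" and cM: "c \<in> M"
    using c by (auto simp: geodesic_hull_def)
  have M: "a \<in> M" "b \<in> M"
    using ab A by auto
  have "d c s + d a b \<le> d c a + d s b + D \<or> d c s + d a b \<le> d c b + d s a + D"
    using four_point[of c s a b] M cM s by blast
  moreover have "gp s a x \<le> t" "gp s b x \<le> t"
    using t ab by auto
  ultimately show ?thesis
    using ab(3) triangle[of a c x] triangle[of b c x] M cM s commute[of c a] commute[of c b] commute[of c s]
      gromov_product_double[of d s c x] gromov_product_double[of d s a x] gromov_product_double[of d s b x]
    by (smt (verit) field_sum_of_halves)
qed

lemma gp_le_of_hull:
  assumes A: "A \<subseteq> M" and s: "s \<in> M" "x \<in> M" and t: "\<And>a. a \<in> A \<Longrightarrow> gp s a x \<le> t"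
    and z: "z \<in> M" "c \<in> ghull A" "d z c \<le> r"
  shows "gp s z x \<le> t + D / 2 + r"
  using gp_hull_le[OF A s t z(2)] gp_lipschitz[of s x z c] s z hull_subset[of A] gp_commute[of s x z] gp_commute[of s x c]
  by fastforce

lemma hull_dist_le:
  assumes A: "A \<subseteq> M" and s: "s \<in> M" and t: "\<And>a. a \<in> A \<Longrightarrow> d a s \<le> t" and c: "c \<in> ghull A"
  shows "d c s \<le> 2 * t"
proof -
  obtain a b where ab: "a \<in> A" "b \<in> A" "d a c + d c b = d a b" and cM: "c \<in> M"
    using c by (auto simp: geodesic_hull_def)
  then show ?thesis
    using t[OF ab(1)] t[OF ab(2)] A triangle[of c a s] triangle[of c b s] triangle[of a s b] s
      commute[of a c] commute[of s b] by fastforce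
qed

lemma coarse_projection_exists:
  assumes A: "A \<subseteq> M" "A \<noteq> {}" and x: "x \<in> M"
  obtains p where "p \<in> ghull A" "\<And>q. q \<in> ghull A \<Longrightarrow> d x p \<le> d x q + D / 2"
proof -
  define s where "s = Inf (d x ` ghull A)"
  have ne: "d x ` ghull A \<noteq> {}"
    using A hull_superset by blast
  have bdd: "bdd_below (d x ` ghull A)"
    by (rule bdd_belowI[of _ 0]) auto
  obtain p where p: "p \<in> ghull A" "d x p < s + D / 2"
    using cInf_lessD[OF ne, of "s + D / 2"] D_pos unfolding s_def by force
  moreover have "s \<le> d x q" if "q \<in> ghull A" for q
    unfolding s_def using bdd that by (intro cInf_lower) auto
  ultimately show thesis
    using that by force
qed

text \<open>Take \<open>P i\<close> almost farthest from \<open>x\<close>. For \<open>y\<close>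
  common to \<open>A i\<close> and \<open>A j\<close>, geodesics from \<open>x\<close> to
  \<open>y\<close> nearly pass through \<open>P i\<close>, and \<open>P j\<close> is not much
  farther from \<open>x\<close>. The four-point inequality leaves two options: \<open>P j\<close> is
  near \<open>P i\<close>, or \<open>P i\<close> is nearly between \<open>P j\<close> and
  \<open>y\<close>, where quasiconvexity of the hull of \<open>A j\<close> applies.\<close>

theorem coarse_Helly:
  assumes sub: "\<And>i. i \<in> I \<Longrightarrow> A i \<subseteq> M" and I: "I \<noteq> {}"
    and meet: "\<And>i j. i \<in> I \<Longrightarrow> j \<in> I \<Longrightarrow> A i \<inter> A j \<noteq> {}"
    and x: "x \<in> M" and bound: "\<And>i. i \<in> I \<Longrightarrow> \<exists>a\<in>A i. d x a \<le> R"
  obtains i p where "i \<in> I" "coarse_projection (A i) x p" "d x p \<le> R + D"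
    "\<And>j. j \<in> I \<Longrightarrow> \<exists>q\<in>ghull (A j). d p q \<le> 9 * D"
proof -
  have "\<exists>p. p \<in> ghull (A i) \<and> (\<forall>q\<in>ghull (A i). d x p \<le> d x q + D / 2)" if "i \<in> I" for i
    using coarse_projection_exists[OF sub[OF that]] meet[OF that that] x by (metis inf.idem)
  then obtain P where P: "\<And>i. i \<in> I \<Longrightarrow> P i \<in> ghull (A i)"
    "\<And>i q. i \<in> I \<Longrightarrow> q \<in> ghull (A i) \<Longrightarrow> d x (P i) \<le> d x q + D / 2"
    by metis
  have P_proj: "coarse_projection (A i) x (P i)" if "i \<in> I" for i
    using P that D_pos by (fastforce simp: coarse_projection_def)
  have P_le: "d x (P i) \<le> R + D" if "i \<in> I" for i
    using bound[OF that] P(2)[OF that] hull_superset[OF sub[OF that]] D_pos by fastforce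
  define s where "s = Sup ((\<lambda>i. d x (P i)) ` I)"
  have bdd: "bdd_above ((\<lambda>i. d x (P i)) ` I)"
    using P_le by (intro bdd_aboveI[of _ "R + D"]) auto
  obtain i where i: "i \<in> I" "s - D < d x (P i)"
    using less_cSupD[of "(\<lambda>i. d x (P i)) ` I" "s - D"] I D_pos unfolding s_def by auto
  have le_s: "d x (P j) \<le> s" if "j \<in> I" for j
    unfolding s_def using bdd that by (intro cSup_upper) auto
  show thesis
  proof (rule that[of i "P i"])
    fix j assume j: "j \<in> I"
    let ?p = "P i" and ?q = "P j"
    obtain y where y: "y \<in> A i" "y \<in> A j"
      using meet[OF i(1) j] by auto
    have M: "?p \<in> M" "?q \<in> M" "y \<in> M"
      using P(1) i(1) j hull_subset y sub by blast+
    have 1: "d x ?p + d ?p y \<le> d x y + 7 * D"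
      using coarse_projection_between[OF sub x P_proj] i y by blast
    have 2: "d x ?q \<le> d x ?p + D"
      using le_s[OF j] i(2) by linarith
    have "d ?q ?p + d x y \<le> d ?q x + d ?p y + D \<or> d ?q ?p + d x y \<le> d ?q y + d ?p x + D"
      using four_point[of ?q ?p x y] M x by blast
    then consider "d ?p ?q \<le> 9 * D" | "d ?q ?p + d ?p y \<le> d ?q y + 8 * D"
      using 1 2 commute[of ?q ?p] commute[of ?q x] commute[of ?p x] by linarith
    then show "\<exists>q\<in>ghull (A j). d ?p q \<le> 9 * D"
    proof cases
      case 1
      then show ?thesis using P(1)[OF j] by blast
    next
      case 2
      then have "gp ?p ?q y \<le> 4 * D"
        using commute[of ?p ?q] gromov_product_double by (smt (verit))
      then obtain e where e: "e \<in> M" "d ?q e + d e y = d ?q y" "d ?p e \<le> 5 * D"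
        using exists_between_near[of ?p ?q y] M by (smt (verit))
      obtain q where q: "q \<in> ghull (A j)" "d e q \<le> 3 * D / 2"
        using hull_quasiconvex[OF sub[OF j] P(1)[OF j] y(2) e(1,2)] .
      have "q \<in> M"
        using q(1) hull_subset by blast
      then have "d ?p q \<le> 9 * D"
        using triangle[of ?p e q] M(1) e(1,3) q(2) D_pos by linarith
      then show ?thesis
        using q(1) by blast
    qed
  qed (use i P_proj P_le in auto)
qed

end

section \<open>The four-point condition from slim triangles\<close>

lemma geodesic_segment_between:
  assumes "Metric_space M d" "geodesic_segment M d x y G" "g \<in> G"
  shows "g \<in> M" "d x g + d g y = d x y" "0 \<le> d x g"
proof -
  obtain \<gamma> where \<gamma>: "\<gamma> \<in> {0..d x y} \<rightarrow> M" "\<gamma> 0 = x" "\<gamma> (d x y) = y"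
    "\<forall>s\<in>{0..d x y}. \<forall>t\<in>{0..d x y}. d (\<gamma> s) (\<gamma> t) = \<bar>s - t\<bar>" "G = \<gamma> ` {0..d x y}"
    using assms(2) by (auto simp: geodesic_segment_def)
  obtain t where t: "t \<in> {0..d x y}" "g = \<gamma> t"
    using \<gamma>(5) assms(3) by auto
  show "g \<in> M" using \<gamma>(1) t by auto
  have "d (\<gamma> 0) (\<gamma> t) = \<bar>0 - t\<bar>" "d (\<gamma> t) (\<gamma> (d x y)) = \<bar>t - d x y\<bar>"
    using \<gamma>(4) t by force+
  then show "d x g + d g y = d x y" "0 \<le> d x g"
    using \<gamma> t by auto
qed

lemma geodesic_segment_endpoints:
  assumes "geodesic_segment M d x y G" "0 \<le> d x y"
  shows "x \<in> G" "y \<in> G"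
proof -
  obtain \<gamma> where "\<gamma> 0 = x" "\<gamma> (d x y) = y" "G = \<gamma> ` {0..d x y}"
    using assms(1) by (auto simp: geodesic_segment_def)
  then show "x \<in> G" "y \<in> G"
    using assms(2) by (metis atLeastAtMost_iff imageI order_refl)+
qed

text \<open>Along \<open>G\<close> slimness switches from the side \<open>P\<close> to the side
  \<open>Q\<close>. Where it does, \<open>d x m\<close> is at most
  \<open>d x y - d y m + 2 * E\<close> and at most \<open>d x z - d m z + 4 * E\<close>; the mean of
  the two gives \<open>3 * E\<close>.\<close>

lemma slim_near_point:
  assumes M: "Metric_space M d" and E: "1 \<le> E" and hyp: "hyperbolic_space E M d"
    and x: "x \<in> M" "y \<in> M" "z \<in> M" and G: "geodesic_segment M d y z G"
  obtains m where "m \<in> G" "d x m \<le> gromov_product d x y z + 3 * E"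
proof -
  interpret Metric_space M d by fact
  obtain P where P: "geodesic_segment M d y x P"
    using hyp x unfolding hyperbolic_space_def geodesic_space_def by blast
  obtain Q where Q: "geodesic_segment M d z x Q"
    using hyp x unfolding hyperbolic_space_def geodesic_space_def by blast
  have "G \<subseteq> neighbourhood M d E (P \<union> Q)"
    using hyp x G P Q unfolding hyperbolic_space_def by (metis Un_commute)
  then have slim: "\<exists>a\<in>P \<union> Q. d a g \<le> E" if "g \<in> G" for g
    using that by (auto simp: neighbourhood_def)
  obtain \<gamma> where \<gamma>: "\<gamma> \<in> {0..d y z} \<rightarrow> M" "\<gamma> 0 = y" "\<gamma> (d y z) = z"
    "\<And>s t. s\<in>{0..d y z} \<Longrightarrow> t\<in>{0..d y z} \<Longrightarrow> d (\<gamma> s) (\<gamma> t) = \<bar>s - t\<bar>" "G = \<gamma> ` {0..d y z}"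
    using G by (auto simp: geodesic_segment_def)
  define S where "S = {t\<in>{0..d y z}. \<exists>a\<in>P. d a (\<gamma> t) \<le> E}"
  have "y \<in> P" using geodesic_segment_endpoints[OF P] by simp
  then have 0: "0 \<in> S"
    using \<gamma>(2) x E by (auto simp: S_def intro!: bexI[of _ y])
  have bdd: "bdd_above S"
    by (rule bdd_aboveI[of _ "d y z"]) (auto simp: S_def)
  obtain s where s: "s \<in> S" "Sup S - 1 / 2 < s"
    using less_cSupD[of S "Sup S - 1 / 2"] 0 by auto
  have sle: "s \<le> Sup S"
    using s bdd cSup_upper by blast
  \<comment> \<open>The parameter \<open>s\<close> is at most 1/2 below the supremum; going 1/2
    above it, or to the end point, leaves the neighbourhood of \<open>P\<close> or reaches
    \<open>Q\<close>.\<close>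
  have "\<exists>s'\<in>{0..d y z}. \<bar>s - s'\<bar> \<le> 1 \<and> (\<exists>b\<in>Q. d b (\<gamma> s') \<le> E)"
  proof (cases "d y z \<le> Sup S + 1 / 2")
    case True
    have "z \<in> Q" using geodesic_segment_endpoints[OF Q] by simp
    then show ?thesis
      using True s sle \<gamma>(3) x E by (intro bexI[of _ "d y z"]) (auto simp: S_def abs_if intro!: bexI[of _ z])
  next
    case False
    let ?t = "Sup S + 1 / 2"
    have t: "?t \<in> {0..d y z}"
      using False cSup_upper[OF 0 bdd] by auto
    have "?t \<notin> S"
      using cSup_upper[OF _ bdd, of ?t] by auto
    then have "\<exists>b\<in>Q. d b (\<gamma> ?t) \<le> E"
      using t slim[of "\<gamma> ?t"] \<gamma>(5) by (auto simp: S_def)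
    then show ?thesis
      using t s sle by (intro bexI[OF _ t]) auto
  qed
  then obtain s' b where s': "s' \<in> {0..d y z}" "\<bar>s - s'\<bar> \<le> 1" "b \<in> Q" "d b (\<gamma> s') \<le> E"
    by blast
  obtain a where a: "a \<in> P" "d a (\<gamma> s) \<le> E" and s_in: "s \<in> {0..d y z}"
    using s(1) by (auto simp: S_def)
  let ?m = "\<gamma> s"
  have mG: "?m \<in> G" and mM: "?m \<in> M" "\<gamma> s' \<in> M"
    using \<gamma>(1,5) s_in s' by auto
  have "d (\<gamma> s') ?m \<le> 1"
    using \<gamma>(4)[OF s'(1) s_in] s'(2) by linarith
  moreover have bM: "b \<in> M" "d z b + d b x = d z x"
    using geodesic_segment_between[OF M Q s'(3)] by auto
  moreover have aM: "a \<in> M" "d y a + d a x = d y x"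
    using geodesic_segment_between[OF M P a(1)] by auto
  ultimately have "d b ?m \<le> 2 * E"
    using triangle[of b "\<gamma> s'" ?m] mM s'(4) E by linarith
  moreover have "d y ?m + d ?m z = d y z"
    using geodesic_segment_between[OF M G mG] by auto
  ultimately have "d x ?m \<le> gromov_product d x y z + 3 * E"
    using aM bM a(2) mM x triangle[of x a ?m] triangle[of x b ?m] triangle[of y a ?m] triangle[of ?m b z]
      commute[of x a] commute[of x y] commute[of ?m b] commute[of x b] commute[of z b] commute[of x z]
      gromov_product_double[of d x y z] by linarith
  with mG that show thesis
    by blast
qed

text \<open>A point of the side from \<open>x\<close> to \<open>y\<close> is within
  \<open>gp w x y + 3 * E\<close> of \<open>w\<close>, and slimness moves it by \<open>E\<close> to
  a point \<open>n\<close> of another side. Joining \<open>w\<close> to both ends of that side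
  through \<open>n\<close> counts \<open>d w n\<close> twice, hence \<open>8 * E\<close>.\<close>

lemma hyperbolic_space_imp_gromov_hyperbolic:
  assumes E: "1 \<le> E" and hyp: "hyperbolic_space E M d"
  shows "gromov_hyperbolic M d (8 * E)"
proof -
  have MS: "Metric_space M d" and geo: "\<And>x y. x \<in> M \<Longrightarrow> y \<in> M \<Longrightarrow> \<exists>G. geodesic_segment M d x y G"
    using hyp by (auto simp: hyperbolic_space_def geodesic_space_def)
  interpret Metric_space M d by fact
  show ?thesis
  proof unfold_locales
    show "0 < 8 * E" using E by simp
  next
    fix x y z w assume M: "x \<in> M" "y \<in> M" "z \<in> M" "w \<in> M"
    obtain G where G: "geodesic_segment M d x y G" using geo M by blast
    obtain P where P: "geodesic_segment M d x z P" using geo M by blast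
    obtain Q where Q: "geodesic_segment M d y z Q" using geo M by blast
    obtain m where m: "m \<in> G" "d w m \<le> gromov_product d w x y + 3 * E"
      using slim_near_point[OF MS E hyp _ _ _ G] M by blast
    have mM: "m \<in> M" using geodesic_segment_between[OF MS G m(1)] by auto
    have "G \<subseteq> neighbourhood M d E (P \<union> Q)"
      using hyp M G P Q unfolding hyperbolic_space_def by (metis Un_commute)
    then obtain n where n: "n \<in> P \<union> Q" "d n m \<le> E"
      using m(1) by (auto simp: neighbourhood_def)
    show "d x y + d z w \<le> d x z + d y w + 8 * E \<or> d x y + d z w \<le> d x w + d y z + 8 * E"
    proof (cases "n \<in> P")
      case True
      note n' = geodesic_segment_between[OF MS P True]
      show ?thesis
        using m(2) n(2) n' mM M triangle[of w n x] triangle[of w n z] triangle[of w m n]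
          commute[of n x] commute[of m n] commute[of w x] commute[of w y] commute[of w z] commute[of y z]
          gromov_product_double[of d w x y] by linarith
    next
      case False
      then have "n \<in> Q" using n by auto
      note n' = geodesic_segment_between[OF MS Q this]
      show ?thesis
        using m(2) n(2) n' mM M triangle[of w n y] triangle[of w n z] triangle[of w m n]
          commute[of n z] commute[of m n] commute[of w x] commute[of w y] commute[of w z] commute[of y z] commute[of y n]
          gromov_product_double[of d w x y] by linarith
    qed
  next
    fix x y t assume M: "x \<in> M" "y \<in> M" and t: "0 \<le> t" "t \<le> d x y"
    obtain \<gamma> where \<gamma>: "\<gamma> \<in> {0..d x y} \<rightarrow> M" "\<gamma> 0 = x" "\<gamma> (d x y) = y"
      "\<And>s t. s\<in>{0..d x y} \<Longrightarrow> t\<in>{0..d x y} \<Longrightarrow> d (\<gamma> s) (\<gamma> t) = \<bar>s - t\<bar>"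
      using geo[OF M] by (auto simp: geodesic_segment_def)
    show "\<exists>m\<in>M. d x m = t \<and> d m y = d x y - t"
      using \<gamma>(1-3) \<gamma>(4)[of 0 t] \<gamma>(4)[of t "d x y"] t by (intro bexI[of _ "\<gamma> t"]) auto
  qed
qed

section \<open>Domains of a hierarchically hyperbolic space\<close>

context hierarchically_hyperbolic_space
begin

definition D where "D = 8 * E"

text \<open>All sets \<open>\<rho> U V\<close> are bounded, so they are replaced by one of their points.\<close>

definition pt :: "'u \<Rightarrow> 'u \<Rightarrow> 'c" where
  "pt U V = (SOME p. p \<in> \<rho> U V)"

abbreviation pnest where "pnest \<equiv> properly_nested nest"
abbreviation trv where "trv \<equiv> transverse \<SS> nest orth"

definition projects :: "'u \<Rightarrow> 'u \<Rightarrow> bool" where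
  "projects U V \<longleftrightarrow> pnest U V \<or> trv U V"

abbreviation dist_at :: "'u \<Rightarrow> 'x \<Rightarrow> 'x \<Rightarrow> real" where
  "dist_at U x y \<equiv> dC U (\<pi> U x) (\<pi> U y)"

abbreviation gp :: "'u \<Rightarrow> 'c \<Rightarrow> 'c \<Rightarrow> 'c \<Rightarrow> real" where
  "gp U \<equiv> gromov_product (dC U)"

abbreviation hull_at :: "'u \<Rightarrow> 'x set \<Rightarrow> 'c set" where
  "hull_at U A \<equiv> geodesic_hull (C U) (dC U) (\<pi> U ` A)"

lemma D_ge: "8 \<le> D" "D = 8 * E"
  using E_ge_1 by (auto simp: D_def)

lemma gromov_hyperbolic_domain: "U \<in> \<SS> \<Longrightarrow> gromov_hyperbolic (C U) (dC U) D"
  using hyperbolic_space_imp_gromov_hyperbolic[OF E_ge_1 hyperbolic] by (simp add: D_def)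

lemma metric_domain: "U \<in> \<SS> \<Longrightarrow> Metric_space (C U) (dC U)"
  using gromov_hyperbolic_domain gromov_hyperbolic.axioms(1) by blast

lemma \<pi>_in: "U \<in> \<SS> \<Longrightarrow> x \<in> X \<Longrightarrow> \<pi> U x \<in> C U"
  using proj_in by auto

lemma nest_subset: "(U, V) \<in> nest \<Longrightarrow> U \<in> \<SS> \<and> V \<in> \<SS>"
  using nest_partial_order by (auto simp: partial_order_on_def preorder_on_def)

lemma nest_refl: "U \<in> \<SS> \<Longrightarrow> (U, U) \<in> nest"
  using nest_partial_order by (auto simp: partial_order_on_def preorder_on_def refl_on_def)

lemma nest_trans: "(U, V) \<in> nest \<Longrightarrow> (V, W) \<in> nest \<Longrightarrow> (U, W) \<in> nest"
  using nest_partial_order by (auto simp: partial_order_on_def preorder_on_def dest: transD)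

lemma nest_antisym: "(U, V) \<in> nest \<Longrightarrow> (V, U) \<in> nest \<Longrightarrow> U = V"
  using nest_partial_order by (auto simp: partial_order_on_def dest: antisymD)

lemma orth_commute: "(U, V) \<in> orth \<longleftrightarrow> (V, U) \<in> orth"
  using orth_sym by (auto dest: symD)

lemma trv_commute: "trv U V \<longleftrightarrow> trv V U"
  using orth_commute by (auto simp: transverse_def)

lemma domain_cases:
  assumes "U \<in> \<SS>" "V \<in> \<SS>"
  obtains "U = V" | "pnest U V" | "pnest V U" | "trv U V" | "(U, V) \<in> orth"
  using assms by (auto simp: transverse_def properly_nested_def)

lemma projects_in: "projects U V \<Longrightarrow> U \<in> \<SS> \<and> V \<in> \<SS>"
  using nest_subset by (auto simp: projects_def properly_nested_def transverse_def)

lemma rho_props: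
  assumes "projects U V"
  shows "\<rho> U V \<noteq> {}" "\<rho> U V \<subseteq> C V" "pt U V \<in> \<rho> U V" "pt U V \<in> C V"
    "p \<in> \<rho> U V \<Longrightarrow> q \<in> \<rho> U V \<Longrightarrow> dC V p q \<le> E"
proof -
  have *: "\<rho> U V \<noteq> {} \<and> \<rho> U V \<subseteq> C V \<and> ediameter (dC V) (\<rho> U V) \<le> ennreal E"
    using assms nest_rho transverse_rho unfolding projects_def by blast
  then show "\<rho> U V \<noteq> {}" "\<rho> U V \<subseteq> C V" by auto
  show "pt U V \<in> \<rho> U V" unfolding pt_def using * by (meson all_not_in_conv someI)
  then show "pt U V \<in> C V" using * by auto
  show "dC V p q \<le> E" if "p \<in> \<rho> U V" "q \<in> \<rho> U V"
    using * that E_ge_1 ediameter_le_iff[of E "dC V" "\<rho> U V"] by auto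
qed

lemma set_distance_attained:
  assumes V: "V \<in> \<SS>" and ne: "A \<noteq> {}" "B \<noteq> {}" and le: "set_distance (dC V) A B \<le> E"
  obtains a b where "a \<in> A" "b \<in> B" "dC V a b \<le> 2 * E"
proof -
  interpret V: Metric_space "C V" "dC V" using metric_domain[OF V] .
  have "(INF (a, b)\<in>A \<times> B. dC V a b) < 2 * E"
    using le E_ge_1 by (simp add: set_distance_def)
  then obtain z where "z \<in> A \<times> B" "(case z of (a, b) \<Rightarrow> dC V a b) < 2 * E"
    using cInf_lessD[of "(\<lambda>(a, b). dC V a b) ` (A \<times> B)" "2 * E"] ne by auto
  then show thesis
    using that by fastforce
qed

lemma set_distance_greater:
  assumes ne: "A \<noteq> {}" "B \<noteq> {}" and far: "\<And>a b. a \<in> A \<Longrightarrow> b \<in> B \<Longrightarrow> 2 * E \<le> dC V a b"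
  shows "E < set_distance (dC V) A B"
proof -
  have "2 * E \<le> (INF (a, b)\<in>A \<times> B. dC V a b)"
    using assms by (intro cINF_greatest) auto
  then show ?thesis
    using E_ge_1 by (simp add: set_distance_def)
qed

lemma near_pt:
  assumes UV: "projects U V" and p: "p \<in> C V" and le: "set_distance (dC V) {p} (\<rho> U V) \<le> E"
  shows "dC V p (pt U V) \<le> D"
proof -
  interpret V: Metric_space "C V" "dC V" using metric_domain projects_in[OF UV] by blast
  note rho = rho_props[OF UV]
  obtain b where b: "b \<in> \<rho> U V" "dC V p b \<le> 2 * E"
    using set_distance_attained[of V "{p}" "\<rho> U V"] le rho(1) projects_in[OF UV] by blast
  then show ?thesis
    using rho(2,4) rho(5)[OF b(1) rho(3)] V.triangle[of p b "pt U V"] p D_ge E_ge_1 by auto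
qed

lemma transverse_near:
  assumes "trv U V" "x \<in> X"
  shows "dC U (\<pi> U x) (pt V U) \<le> D \<or> dC V (\<pi> V x) (pt U V) \<le> D"
proof -
  have "U \<in> \<SS>" "V \<in> \<SS>" "projects U V" "projects V U"
    using assms trv_commute by (auto simp: transverse_def projects_def)
  then show ?thesis
    using transverse_consistency[OF assms] near_pt \<pi>_in assms(2) by (meson min_le_iff_disj)
qed

text \<open>Bounded geodesic image and nested consistency, combined so that \<open>\<rho>map\<close>
  cancels: the product keeps the geodesic away from \<open>\<rho> U V\<close>, so
  \<open>\<pi> U x\<close> and \<open>\<pi> U y\<close> are within \<open>E\<close> of images under
  \<open>\<rho>map V U\<close> that are within \<open>E\<close> of each other.\<close>

lemma nested_bounded_image:
  assumes UV: "pnest U V" and xy: "x \<in> X" "y \<in> X" and far: "D < gp V (pt U V) (\<pi> V x) (\<pi> V y)"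
  shows "dist_at U x y \<le> D"
proof -
  have pr: "projects U V" using UV by (simp add: projects_def)
  have S: "U \<in> \<SS>" "V \<in> \<SS>" using projects_in[OF pr] by auto
  interpret V: gromov_hyperbolic "C V" "dC V" D using gromov_hyperbolic_domain S by blast
  interpret U: gromov_hyperbolic "C U" "dC U" D using gromov_hyperbolic_domain S by blast
  note rho = rho_props[OF pr]
  have M: "\<pi> V x \<in> C V" "\<pi> V y \<in> C V" "\<pi> U x \<in> C U" "\<pi> U y \<in> C U"
    using \<pi>_in S xy by auto
  obtain G where G: "geodesic_segment (C V) (dC V) (\<pi> V x) (\<pi> V y) G"
    using hyperbolic[OF S(2)] M unfolding hyperbolic_space_def geodesic_space_def by blast
  have ends: "\<pi> V x \<in> G" "\<pi> V y \<in> G"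
    using geodesic_segment_endpoints[OF G] by auto
  have far_G: "2 * E \<le> dC V g r" if "g \<in> G" "r \<in> \<rho> U V" for g r
  proof -
    have g: "g \<in> C V" "dC V (\<pi> V x) g + dC V g (\<pi> V y) = dist_at V x y"
      using geodesic_segment_between[OF V.Metric_space_axioms G that(1)] by auto
    have "dC V (pt U V) r \<le> E" "r \<in> C V"
      using rho that by auto
    then show ?thesis
      using far g(2) V.triangle[of "pt U V" r "\<pi> V x"] V.triangle[of "pt U V" r "\<pi> V y"]
        V.triangle[of r g "\<pi> V x"] V.triangle[of r g "\<pi> V y"] rho(4) g(1) M(1,2)
        V.commute[of r g] V.commute[of g "\<pi> V x"]
        gromov_product_double[of "dC V" "pt U V" "\<pi> V x" "\<pi> V y"] D_ge E_ge_1
      by linarith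
  qed
  have "E < set_distance (dC V) G (\<rho> U V)"
    using set_distance_greater far_G rho(1) ends by blast
  then have "ediameter (dC U) (\<rho>map V U ` G) \<le> ennreal E"
    using bounded_geodesic_image[OF UV M(1,2) G] by simp
  then have 1: "dC U (\<rho>map V U (\<pi> V x)) (\<rho>map V U (\<pi> V y)) \<le> E"
    using ends E_ge_1 ediameter_le_iff[of E "dC U" "\<rho>map V U ` G"] by force
  have 2: "dC U (\<pi> U z) (\<rho>map V U (\<pi> V z)) \<le> E" if z: "z \<in> X" "\<pi> V z \<in> G" for z
  proof -
    have "E < set_distance (dC V) {\<pi> V z} (\<rho> U V)"
      using set_distance_greater[of "{\<pi> V z}" "\<rho> U V"] far_G z rho(1) by auto
    then have "\<not> ennreal (set_distance (dC V) {\<pi> V z} (\<rho> U V)) \<le> ennreal E"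
      using E_ge_1 by (simp add: ennreal_le_iff2)
    then have "ediameter (dC U) ({\<pi> U z} \<union> {\<rho>map V U (\<pi> V z)}) \<le> ennreal E"
      using nest_consistency[OF UV z(1)] by (auto simp: min_le_iff_disj)
    then show ?thesis
      using E_ge_1 ediameter_le_iff[of E "dC U" "{\<pi> U z} \<union> {\<rho>map V U (\<pi> V z)}"] by simp
  qed
  have im: "\<rho>map V U (\<pi> V x) \<in> C U" "\<rho>map V U (\<pi> V y) \<in> C U"
    using nest_rho_map[OF UV] M by auto
  show ?thesis
    using 1 2[OF xy(1) ends(1)] 2[OF xy(2) ends(2)] im M
      U.triangle[of "\<pi> U x" "\<rho>map V U (\<pi> V x)" "\<pi> U y"]
      U.triangle[of "\<rho>map V U (\<pi> V x)" "\<rho>map V U (\<pi> V y)" "\<pi> U y"]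
      U.commute[of "\<pi> U y" "\<rho>map V U (\<pi> V y)"] D_ge E_ge_1 by linarith
qed

lemma nested_pt_near:
  assumes "(T, W) \<in> nest" "pnest W V"
  shows "dC V (pt T V) (pt W V) \<le> D"
proof -
  have pr: "projects T V" "projects W V"
    using assms nest_trans nest_antisym by (auto simp: projects_def properly_nested_def)
  have S: "V \<in> \<SS>" using projects_in[OF pr(1)] by auto
  interpret V: gromov_hyperbolic "C V" "dC V" D using gromov_hyperbolic_domain S by blast
  note T = rho_props[OF pr(1)] and W = rho_props[OF pr(2)]
  obtain a b where ab: "a \<in> \<rho> T V" "b \<in> \<rho> W V" "dC V a b \<le> 2 * E"
    using set_distance_attained[OF S T(1) W(1)] rho_consistency[OF assms(1)] assms(2) by blast
  moreover have "a \<in> C V" "b \<in> C V"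
    using T(2) W(2) ab by auto
  ultimately show ?thesis
    using T(4) W(4) T(5)[OF T(3) ab(1)] W(5)[OF ab(2) W(3)] D_ge E_ge_1
      V.triangle[of "pt T V" a "pt W V"] V.triangle[of a b "pt W V"]
    by linarith
qed

definition realises_on :: "'u set \<Rightarrow> ('u \<Rightarrow> 'c) \<Rightarrow> 'x \<Rightarrow> bool" where
  "realises_on \<V> b x \<longleftrightarrow> x \<in> X \<and> (\<forall>V\<in>\<V>. dC V (\<pi> V x) (b V) \<le> D \<and>
     (\<forall>W. projects V W \<longrightarrow> dC W (\<pi> W x) (pt V W) \<le> D))"

lemma realises_on_exists:
  assumes "\<V> \<subseteq> \<SS>" "pairwise (\<lambda>U V. (U, V) \<in> orth) \<V>" "\<And>V. V \<in> \<V> \<Longrightarrow> b V \<in> C V"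
  obtains x where "realises_on \<V> b x"
proof -
  obtain x where x: "x \<in> X" "\<forall>U\<in>\<V>. dC U (\<pi> U x) (b U) \<le> E \<and>
        (\<forall>V\<in>\<SS>. pnest U V \<or> trv U V \<longrightarrow> set_distance (dC V) {\<pi> V x} (\<rho> U V) \<le> E)"
    using partial_realisation[OF assms] by blast
  have "realises_on \<V> b x"
    unfolding realises_on_def
    using x near_pt \<pi>_in projects_in D_ge E_ge_1 by (smt (verit) projects_def)
  with that show thesis .
qed

lemma realises_onD:
  assumes "realises_on \<V> b x"
  shows "x \<in> X" "V \<in> \<V> \<Longrightarrow> dC V (\<pi> V x) (b V) \<le> D"
    "V \<in> \<V> \<Longrightarrow> projects V W \<Longrightarrow> dC W (\<pi> W x) (pt V W) \<le> D"
  using assms by (auto simp: realises_on_def)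

text \<open>Partial realisation of the empty family; the empty family of balls has intersection
  \<open>X\<close>.\<close>

lemma X_nonempty: "X \<noteq> {}"
proof -
  obtain x where "realises_on {} (\<lambda>_. undefined) x"
    by (rule realises_on_exists[of "{}"]) auto
  then show ?thesis
    by (auto simp: realises_on_def)
qed

subsection \<open>Complexity\<close>

definition height :: nat where "height = nat \<lfloor>E\<rfloor>"

definition chains_above :: "'u \<Rightarrow> 'u set set" where
  "chains_above W = {\<C>. \<C> \<subseteq> {V. (W, V) \<in> nest} \<and> pairwise (\<lambda>U V. (U, V) \<in> nest \<or> (V, U) \<in> nest) \<C>}"

text \<open>Longest nesting chain upwards from \<open>W\<close>. It grows strictly on passing to
  smaller domains and is at most \<open>height\<close>, which makes it the measure for inductions
  over domains.\<close>

definition colevel :: "'u \<Rightarrow> nat" where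
  "colevel W = Max (card ` chains_above W)"

lemma chains_above_card:
  assumes "\<C> \<in> chains_above W"
  shows "finite \<C>" "card \<C> \<le> height"
proof -
  have "finite \<C> \<and> real (card \<C>) \<le> E"
    using assms nest_subset by (intro finite_complexity) (auto simp: chains_above_def)
  then show "finite \<C>" "card \<C> \<le> height"
    by (auto simp: height_def le_nat_iff le_floor_iff)
qed

lemma finite_card_chains_above: "finite (card ` chains_above W)"
proof (rule finite_subset)
  show "card ` chains_above W \<subseteq> {..height}"
    using chains_above_card(2) by blast
qed simp

lemma card_le_colevel: "\<C> \<in> chains_above W \<Longrightarrow> card \<C> \<le> colevel W"
  unfolding colevel_def using finite_card_chains_above by (intro Max_ge) auto

lemma colevel_attained:
  obtains \<C> where "\<C> \<in> chains_above W" "card \<C> = colevel W"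
proof -
  have "{} \<in> chains_above W" by (auto simp: chains_above_def)
  then have "colevel W \<in> card ` chains_above W"
    unfolding colevel_def using finite_card_chains_above by (intro Max_in) auto
  with that show thesis by auto
qed

lemma colevel_le_height: "colevel W \<le> height"
  using colevel_attained chains_above_card by metis

lemma colevel_pos: "W \<in> \<SS> \<Longrightarrow> 0 < colevel W"
  using card_le_colevel[of "{W}" W] nest_refl by (auto simp: chains_above_def)

lemma colevel_less:
  assumes "pnest T W"
  shows "colevel W < colevel T"
proof -
  obtain \<C> where \<C>: "\<C> \<in> chains_above W" "card \<C> = colevel W"
    using colevel_attained .
  have TW: "(T, W) \<in> nest" "T \<noteq> W" using assms by (auto simp: properly_nested_def)
  then have above: "(T, V) \<in> nest" if "V \<in> \<C>" for V
    using \<C>(1) that nest_trans by (auto simp: chains_above_def)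
  have "T \<notin> \<C>"
    using \<C>(1) TW nest_antisym by (auto simp: chains_above_def)
  moreover have "insert T \<C> \<in> chains_above T"
    using \<C>(1) above TW nest_refl nest_subset by (auto simp: chains_above_def pairwise_insert)
  ultimately show ?thesis
    using card_le_colevel[of "insert T \<C>" T] chains_above_card(1)[OF \<C>(1)] \<C>(2) by simp
qed

text \<open>A unique maximal element of an infinite order need not be greatest; here finite
  complexity puts every domain below some maximal one.\<close>

lemma top_exists:
  assumes "T0 \<in> \<SS>"
  obtains M where "M \<in> \<SS>" "\<And>T. T \<in> \<SS> \<Longrightarrow> (T, M) \<in> nest"
proof -
  have above: "\<exists>V. (T, V) \<in> nest \<and> (\<forall>U\<in>\<SS>. (V, U) \<in> nest \<longrightarrow> U = V)" if "T \<in> \<SS>" for T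
    using that
  proof (induction "colevel T" arbitrary: T rule: less_induct)
    case less
    show ?case
    proof (cases "\<exists>U. pnest T U")
      case True
      then obtain U where U: "pnest T U" by auto
      then have TU: "(T, U) \<in> nest" "U \<in> \<SS>"
        using nest_subset by (auto simp: properly_nested_def)
      then obtain V where "(U, V) \<in> nest" "\<forall>W\<in>\<SS>. (V, W) \<in> nest \<longrightarrow> W = V"
        using less(1)[OF colevel_less[OF U]] by blast
      then show ?thesis
        using TU nest_trans by blast
    next
      case False
      then show ?thesis
        using nest_refl less(2) by (auto simp: properly_nested_def)
    qed
  qed
  obtain M where "M \<in> \<SS>" "\<And>V. V \<in> \<SS> \<Longrightarrow> \<forall>U\<in>\<SS>. (V, U) \<in> nest \<longrightarrow> U = V \<Longrightarrow> V = M"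
    using nest_unique_maximal assms by (metis empty_iff)
  with that above nest_subset show thesis by metis
qed

text \<open>The members orthogonal to a given member \<open>U\<close> lie in a container properly
  nested in \<open>T\<close>, so removing \<open>U\<close> allows \<open>T\<close> to be replaced by
  a domain of larger colevel.\<close>

lemma orth_family_card:
  assumes "finite \<V>" "pairwise (\<lambda>U V. (U, V) \<in> orth) \<V>" "\<And>V. V \<in> \<V> \<Longrightarrow> (V, T) \<in> nest"
  shows "card \<V> + colevel T \<le> height + 1"
  using assms
proof (induction \<V> arbitrary: T rule: finite_induct)
  case empty
  then show ?case using colevel_le_height[of T] by simp
next
  case (insert U \<V>)
  show ?case
  proof (cases "\<V> = {}")
    case True
    then show ?thesis using colevel_le_height[of T] by simp
  next
    case False
    have orth: "(V, U) \<in> orth" if "V \<in> \<V>" for V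
      using insert(2,4) that by (auto simp: pairwise_insert)
    obtain W where W: "pnest W T" "\<forall>V. (V, T) \<in> nest \<and> (V, U) \<in> orth \<longrightarrow> (V, W) \<in> nest"
      using orth_container[of U T] insert(5) False orth by (metis all_not_in_conv insertCI)
    have "card \<V> + colevel W \<le> height + 1"
      using insert(3)[of W] insert(4,5) W(2) orth by (auto simp: pairwise_insert)
    then show ?thesis
      using colevel_less[OF W(1)] insert(1,2) by simp
  qed
qed

text \<open>Large links as a tree of depth at most \<open>height\<close>: a relevant domain below
  \<open>W\<close> is \<open>W\<close> or lies below one of the boundedly many domains that the
  axiom provides. The bound \<open>B\<close> holds only above members of \<open>\<T>\<close>, so
  nodes with no member below them are pruned.\<close>

lemma large_links_count:
  assumes xy: "x \<in> X" "y \<in> X" and \<T>: "finite \<T>" "\<T> \<subseteq> \<SS>" "\<And>T. T \<in> \<T> \<Longrightarrow> E \<le> dist_at T x y"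
    and B: "\<And>W T. T \<in> \<T> \<Longrightarrow> (T, W) \<in> nest \<Longrightarrow> dist_at W x y \<le> B"
  shows "card \<T> \<le> (nat \<lfloor>E * B + E\<rfloor> + 1) ^ height"
proof -
  \<comment> \<open>At most \<open>?K - 1\<close> branches leave a node; the extra 1 pays for the
    node itself.\<close>
  let ?K = "nat \<lfloor>E * B + E\<rfloor> + 1"
  let ?U = "\<lambda>W. {T \<in> \<T>. (T, W) \<in> nest}"
  have below: "card (?U W) \<le> ?K ^ (height - colevel W)" if "W \<in> \<SS>" for W
    using that
  proof (induction "height - colevel W" arbitrary: W rule: less_induct)
    case less
    show ?case
    proof (cases "?U W = {}")
      case True
      then show ?thesis by (simp only: card.empty le0)
    next
      case False
      then have "dist_at W x y \<le> B" using B by auto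
      then have EB: "E * dist_at W x y + E \<le> E * B + E" using E_ge_1 by simp
      obtain \<L> where L: "finite \<L>" "int (card \<L>) \<le> \<lfloor>E * dist_at W x y + E\<rfloor>" "\<forall>T\<in>\<L>. pnest T W"
        "\<forall>T. pnest T W \<longrightarrow> (\<exists>T'\<in>\<L>. (T, T') \<in> nest) \<or> dist_at T x y < E"
        using large_links[OF less(2) xy refl] by blast
      have cardL: "card \<L> \<le> ?K - 1"
        using L(2) floor_mono[OF EB] by linarith
      have sub: "?U W \<subseteq> insert W (\<Union>T'\<in>\<L>. ?U T')"
        using L(4) \<T>(3) by (fastforce simp: properly_nested_def)
      have fin: "finite (?U T)" for T using \<T>(1) by simp
      show ?thesis
      proof (cases "\<L> = {}")
        case True
        then have "card (?U W) \<le> card {W}"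
          using sub by (intro card_mono) auto
        then show ?thesis by (simp add: order.trans[OF _ one_le_power])
      next
        case False
        then obtain T0 where "T0 \<in> \<L>" by auto
        then have "colevel W < height"
          using L(3) colevel_less colevel_le_height[of T0] by fastforce
        then obtain m where m: "height - colevel W = Suc m"
          by (metis Suc_diff_Suc)
        have each: "card (?U T') \<le> ?K ^ m" if "T' \<in> \<L>" for T'
        proof -
          have "colevel W < colevel T'" "T' \<in> \<SS>"
            using L(3) that colevel_less nest_subset by (auto simp: properly_nested_def)
          moreover from this have "height - colevel T' \<le> m" "height - colevel T' < height - colevel W"
            using m by linarith+
          ultimately show ?thesis
            using less(1)[of T'] by (meson le_add2 order.trans power_increasing)
        qed
        have "card (?U W) \<le> card (insert W (\<Union>T'\<in>\<L>. ?U T'))"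
          using sub L(1) fin by (intro card_mono) auto
        also have "\<dots> \<le> Suc (card (\<Union>T'\<in>\<L>. ?U T'))"
          by (rule card_insert_le_m1) auto
        also have "\<dots> \<le> Suc (\<Sum>T'\<in>\<L>. card (?U T'))"
          using card_UN_le[OF L(1)] by simp
        also have "\<dots> \<le> Suc (card \<L> * ?K ^ m)"
          using sum_bounded_above[of \<L> "\<lambda>T'. card (?U T')" "?K ^ m"] each by simp
        also have "\<dots> \<le> Suc ((?K - 1) * ?K ^ m)"
          using cardL by (simp add: mult_right_mono)
        also have "\<dots> \<le> ?K ^ Suc m"
          by simp
        finally show ?thesis using m by simp
      qed
    qed
  qed
  show ?thesis
  proof (cases "\<T> = {}")
    case False
    then obtain M where M: "M \<in> \<SS>" "\<And>T. T \<in> \<SS> \<Longrightarrow> (T, M) \<in> nest"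
      using top_exists \<T>(2) by blast
    then have "?U M = \<T>" using \<T>(2) by auto
    then have "card \<T> \<le> ?K ^ (height - colevel M)"
      using below[OF M(1)] by simp
    also have "\<dots> \<le> ?K ^ height"
      by (rule power_increasing) auto
    finally show ?thesis .
  qed simp
qed


section \<open>Consistent tuples\<close>

text \<open>
  The nested condition compares the tuple with points of \<open>X\<close> and avoids the maps \<open>\<rho>map\<close>:
  a large Gromov product means that the geodesic in \<open>C V\<close> stays away from \<open>\<rho> U V\<close>.
\<close>

definition consistent :: "real \<Rightarrow> ('u \<Rightarrow> 'c) \<Rightarrow> bool" where
  "consistent \<kappa> b \<longleftrightarrow> (\<forall>U\<in>\<SS>. b U \<in> C U) \<and>
    (\<forall>U V. trv U V \<longrightarrow> dC U (b U) (pt V U) \<le> \<kappa> \<or> dC V (b V) (pt U V) \<le> \<kappa>) \<and>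
    (\<forall>U V. \<forall>y\<in>X. pnest U V \<longrightarrow> \<kappa> < gp V (pt U V) (\<pi> V y) (b V) \<longrightarrow> dC U (\<pi> U y) (b U) \<le> \<kappa>)"

lemma consistentD:
  assumes "consistent \<kappa> b"
  shows "U \<in> \<SS> \<Longrightarrow> b U \<in> C U"
    "trv U V \<Longrightarrow> dC U (b U) (pt V U) \<le> \<kappa> \<or> dC V (b V) (pt U V) \<le> \<kappa>"
    "pnest U V \<Longrightarrow> y \<in> X \<Longrightarrow> \<kappa> < gp V (pt U V) (\<pi> V y) (b V) \<Longrightarrow> dC U (\<pi> U y) (b U) \<le> \<kappa>"
  using assms by (auto simp: consistent_def)

text \<open>Let \<open>H U\<close> be the member whose projection is \<open>p U\<close>. As
  \<open>p V\<close> is near the hull of \<open>H U\<close> too, what holds in \<open>C V\<close>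
  for all points of \<open>H U\<close> passes to \<open>p V\<close>. Betweenness supplies such
  facts: all of \<open>H U\<close> lies beyond \<open>p U\<close> as seen from
  \<open>x\<close>.\<close>

theorem Helly_tuple:
  assumes sub: "\<And>H. H \<in> \<H> \<Longrightarrow> H \<subseteq> X" and ne: "\<H> \<noteq> {}"
    and meet: "\<And>H K. H \<in> \<H> \<Longrightarrow> K \<in> \<H> \<Longrightarrow> H \<inter> K \<noteq> {}"
    and x: "x \<in> X" and near: "\<And>H. H \<in> \<H> \<Longrightarrow> \<exists>h\<in>H. d x h \<le> R"
  obtains p where "consistent (15 * D) p"
    "\<And>U. U \<in> \<SS> \<Longrightarrow> dC U (\<pi> U x) (p U) \<le> E * R + E + D"
    "\<And>U H. U \<in> \<SS> \<Longrightarrow> H \<in> \<H> \<Longrightarrow> \<exists>q\<in>hull_at U H. dC U (p U) q \<le> 9 * D"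
proof -
  have "\<exists>H p. H \<in> \<H> \<and> gromov_hyperbolic.coarse_projection (C U) (dC U) D (\<pi> U ` H) (\<pi> U x) p \<and>
      dC U (\<pi> U x) p \<le> E * R + E + D \<and> (\<forall>K\<in>\<H>. \<exists>q\<in>hull_at U K. dC U p q \<le> 9 * D)"
    if U: "U \<in> \<SS>" for U
  proof -
    interpret U: gromov_hyperbolic "C U" "dC U" D using gromov_hyperbolic_domain U .
    show ?thesis
    proof (rule U.coarse_Helly[of \<H> "\<lambda>H. \<pi> U ` H" "\<pi> U x" "E * R + E"])
      show "\<pi> U ` H \<subseteq> C U" if "H \<in> \<H>" for H
        using sub[OF that] \<pi>_in[OF U] by auto
      show "\<pi> U ` H \<inter> \<pi> U ` K \<noteq> {}" if "H \<in> \<H>" "K \<in> \<H>" for H K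
        using meet[OF that] by auto
      show "\<exists>a\<in>\<pi> U ` H. dC U (\<pi> U x) a \<le> E * R + E" if H: "H \<in> \<H>" for H
      proof -
        obtain h where h: "h \<in> H" "d x h \<le> R" using near[OF H] by auto
        then have "E * d x h \<le> E * R" using E_ge_1 by simp
        then show ?thesis
          using proj_coarsely_Lipschitz[OF U x, of h] h sub[OF H] by (intro bexI[of _ "\<pi> U h"]) auto
      qed
      show ?thesis if "K \<in> \<H>" "U.coarse_projection (\<pi> U ` K) (\<pi> U x) q" "dC U (\<pi> U x) q \<le> E * R + E + D"
        "\<And>L. L \<in> \<H> \<Longrightarrow> \<exists>c\<in>hull_at U L. dC U q c \<le> 9 * D" for K q
        using that by blast
    qed (use ne \<pi>_in U x in auto)
  qed
  then obtain H p where Hp: "\<And>U. U \<in> \<SS> \<Longrightarrow> H U \<in> \<H>"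
    "\<And>U. U \<in> \<SS> \<Longrightarrow> gromov_hyperbolic.coarse_projection (C U) (dC U) D (\<pi> U ` H U) (\<pi> U x) (p U)"
    "\<And>U. U \<in> \<SS> \<Longrightarrow> dC U (\<pi> U x) (p U) \<le> E * R + E + D"
    "\<And>U K. U \<in> \<SS> \<Longrightarrow> K \<in> \<H> \<Longrightarrow> \<exists>q\<in>hull_at U K. dC U (p U) q \<le> 9 * D"
    by metis
  have img: "\<pi> U ` K \<subseteq> C U" if "U \<in> \<SS>" "K \<in> \<H>" for U K
    using \<pi>_in sub that by blast
  have hull_in: "hull_at U K \<subseteq> C U" for U K
    by (auto simp: geodesic_hull_def)
  have pC: "p U \<in> C U" if "U \<in> \<SS>" for U
    using Hp(2)[OF that] gromov_hyperbolic.coarse_projection_def[OF gromov_hyperbolic_domain[OF that]]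
      hull_in by blast
  have between: "dC U (\<pi> U x) (p U) + dC U (p U) (\<pi> U w) \<le> dist_at U x w + 7 * D"
    if "U \<in> \<SS>" "w \<in> H U" for U w
    using gromov_hyperbolic.coarse_projection_between[OF gromov_hyperbolic_domain[OF that(1)]
        img[OF that(1) Hp(1)[OF that(1)]] _ Hp(2)[OF that(1)], of "\<pi> U w"] that \<pi>_in x by auto
  have close_hull: "dC V (p V) s \<le> 2 * t + 9 * D"
    if VK: "V \<in> \<SS>" "K \<in> \<H>" "s \<in> C V" "\<And>w. w \<in> K \<Longrightarrow> dC V (\<pi> V w) s \<le> t" for V K s t
  proof -
    interpret V: gromov_hyperbolic "C V" "dC V" D using gromov_hyperbolic_domain VK(1) .
    obtain q where q: "q \<in> hull_at V K" "dC V (p V) q \<le> 9 * D"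
      using Hp(4) VK by blast
    have "dC V q s \<le> 2 * t"
      using V.hull_dist_le[OF img[OF VK(1,2)] VK(3) _ q(1), of t] VK(4) by auto
    moreover have "q \<in> C V"
      using q(1) hull_in by auto
    ultimately show ?thesis
      using V.triangle[of "p V" q s] q(2) VK(3) pC[OF VK(1)] by linarith
  qed
  \<comment> \<open>All of \<open>H U\<close> is far from \<open>pt V U\<close>, hence near
    \<open>pt U V\<close> in \<open>C V\<close>, and \<open>p V\<close> follows at distance
    \<open>2 * D + 9 * D\<close>.\<close>
  have trv_step: "dC V (p V) (pt U V) \<le> 15 * D"
    if UV: "trv U V" and x_near: "dC U (\<pi> U x) (pt V U) \<le> D" and far: "15 * D < dC U (p U) (pt V U)" for U V
  proof -
    have S: "U \<in> \<SS>" "V \<in> \<SS>" "projects U V" "projects V U"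
      using UV trv_commute by (auto simp: transverse_def projects_def)
    interpret U: gromov_hyperbolic "C U" "dC U" D using gromov_hyperbolic_domain S by blast
    have "dC V (\<pi> V w) (pt U V) \<le> D" if w: "w \<in> H U" for w
    proof -
      have wX: "w \<in> X" using w sub Hp(1) S by blast
      have "\<pi> U w \<in> C U" "\<pi> U x \<in> C U" "pt V U \<in> C U"
        using \<pi>_in wX x S rho_props by auto
      then have "D < dC U (\<pi> U w) (pt V U)"
        using between[OF S(1) w] far x_near D_ge E_ge_1 pC[OF S(1)] U.nonneg[of "p U" "\<pi> U w"]
          U.triangle[of "\<pi> U x" "pt V U" "\<pi> U w"] U.triangle[of "p U" "\<pi> U x" "pt V U"]
          U.commute[of "pt V U" "\<pi> U w"] U.commute[of "p U" "\<pi> U x"] by linarith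
      then show ?thesis
        using transverse_near[OF UV wX] by linarith
    qed
    then have "dC V (p V) (pt U V) \<le> 2 * D + 9 * D"
      using close_hull[OF S(2) Hp(1)[OF S(1)]] rho_props(4)[OF S(3)] by blast
    then show ?thesis
      using D_ge E_ge_1 by linarith
  qed
  have trv_consistent: "dC U (p U) (pt V U) \<le> 15 * D \<or> dC V (p V) (pt U V) \<le> 15 * D" if "trv U V" for U V
    using transverse_near[OF that x] trv_step[of U V] trv_step[of V U] that trv_commute by (meson not_le)
  have nest_consistent: "dC U (\<pi> U y) (p U) \<le> 15 * D"
    if UV: "pnest U V" and y: "y \<in> X" and far: "15 * D < gp V (pt U V) (\<pi> V y) (p V)" for U V y
  proof -
    have S: "U \<in> \<SS>" "V \<in> \<SS>" "projects U V"
      using UV nest_subset by (auto simp: properly_nested_def projects_def)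
    interpret U: gromov_hyperbolic "C U" "dC U" D using gromov_hyperbolic_domain S by blast
    interpret V: gromov_hyperbolic "C V" "dC V" D using gromov_hyperbolic_domain S by blast
    let ?s = "pt U V"
    have s: "?s \<in> C V" using rho_props S by blast
    have M: "\<pi> V x \<in> C V" "\<pi> V y \<in> C V" "p V \<in> C V" "\<pi> U x \<in> C U" "\<pi> U y \<in> C U" "p U \<in> C U"
      using \<pi>_in S x y pC by auto
    show ?thesis
    \<comment> \<open>The question is whether \<open>x\<close> and \<open>p V\<close> are on the
      same side of \<open>?s\<close>. The threshold is twice \<open>D + D / 2 + 9 * D\<close>, the
      bound that yields the contradiction in the first case; the second case needs
      \<open>2 * (15 * D) - 8 * D\<close> to exceed it.\<close>
    proof (cases "21 * D < 2 * gp V ?s (\<pi> V x) (p V)")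
      case True
      have "D < gp V ?s (\<pi> V x) (\<pi> V y)"
        using V.gp_min[OF s M(1,3,2)] True far V.gp_commute[of ?s "\<pi> V y" "p V"] D_ge E_ge_1
        by linarith
      then have xy: "dist_at U x y \<le> D"
        using nested_bounded_image[OF UV x y] by simp
      \<comment> \<open>Otherwise all of \<open>H U\<close> is far from \<open>x\<close> in
        \<open>C U\<close>, so \<open>?s\<close> separates it from \<open>x\<close> in
        \<open>C V\<close>, and \<open>p V\<close> with it.\<close>
      have "dC U (\<pi> U x) (p U) \<le> 9 * D"
      proof (rule ccontr)
        assume far_U: "\<not> dC U (\<pi> U x) (p U) \<le> 9 * D"
        have "gp V ?s (\<pi> V w) (\<pi> V x) \<le> D" if w: "w \<in> H U" for w
        proof -
          have wX: "w \<in> X" using w sub Hp(1) S by blast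
          have "D < dist_at U x w"
            using between[OF S(1) w] far_U D_ge E_ge_1 U.nonneg[of "p U" "\<pi> U w"] by linarith
          then show ?thesis
            using nested_bounded_image[OF UV x wX] V.gp_commute[of ?s "\<pi> V w" "\<pi> V x"] by linarith
        qed
        moreover obtain q where "q \<in> hull_at V (H U)" "dC V (p V) q \<le> 9 * D"
          using Hp(1,4) S by blast
        ultimately have "gp V ?s (p V) (\<pi> V x) \<le> D + D / 2 + 9 * D"
          using V.gp_le_of_hull[OF img[OF S(2) Hp(1)[OF S(1)]] s M(1), of D "p V" q "9 * D"] M by auto
        with True show False
          using V.gp_commute[of ?s "p V" "\<pi> V x"] by linarith
      qed
      then show ?thesis
        using xy U.triangle[of "\<pi> U y" "\<pi> U x" "p U"] M U.commute[of "\<pi> U x" "\<pi> U y"] D_ge E_ge_1 by linarith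
    next
      case False
      \<comment> \<open>The points of \<open>H V\<close> lie beyond \<open>p V\<close> as seen from
        \<open>x\<close>, hence on the same side of \<open>?s\<close> as \<open>p V\<close> and
        \<open>y\<close>.\<close>
      have "dC U (\<pi> U w) (\<pi> U y) \<le> D" if w: "w \<in> H V" for w
      proof -
        have wX: "w \<in> X" using w sub Hp(1) S by blast
        have wM: "\<pi> V w \<in> C V" using \<pi>_in wX S by auto
        have "dC V (\<pi> V x) (\<pi> V w) + dC V ?s (p V) \<le> dC V (\<pi> V x) ?s + dC V (\<pi> V w) (p V) + D \<or>
              dC V (\<pi> V x) (\<pi> V w) + dC V ?s (p V) \<le> dC V (\<pi> V x) (p V) + dC V (\<pi> V w) ?s + D"
          using V.four_point[of "\<pi> V x" "\<pi> V w" ?s "p V"] M wM s by blast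
        then have "10 * D < gp V ?s (\<pi> V w) (p V)"
          using between[OF S(2) w] False far V.gp_le_dist(2)[OF s M(2) M(3)]
            gromov_product_double[of "dC V" ?s "\<pi> V x" "p V"]
            gromov_product_double[of "dC V" ?s "\<pi> V w" "p V"]
            V.commute[of "\<pi> V x" ?s] V.commute[of "\<pi> V w" ?s] V.commute[of "p V" "\<pi> V w"] D_ge(1)
          by (smt (verit))
        then have "D < gp V ?s (\<pi> V w) (\<pi> V y)"
          using V.gp_min[OF s wM M(3,2)] far V.gp_commute[of ?s "\<pi> V y" "p V"] D_ge E_ge_1
          by linarith
        then show ?thesis
          using nested_bounded_image[OF UV wX y] by simp
      qed
      then have "dC U (p U) (\<pi> U y) \<le> 2 * D + 9 * D"
        using close_hull[OF S(1) Hp(1)[OF S(2)] M(5)] by blast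
      then show ?thesis
        using U.commute[of "p U" "\<pi> U y"] D_ge E_ge_1 by linarith
    qed
  qed
  have "consistent (15 * D) p"
    using pC trv_consistent nest_consistent by (auto simp: consistent_def)
  with that Hp(3,4) show thesis by blast
qed

section \<open>Realisation of consistent tuples\<close>

text \<open>\<open>misses F b T S\<close> says that, seen from \<open>S\<close>, the tuple \<open>b\<close> lies beyond \<open>T\<close>.\<close>

definition misses :: "real \<Rightarrow> ('u \<Rightarrow> 'c) \<Rightarrow> 'u \<Rightarrow> 'u \<Rightarrow> bool" where
  "misses F b T S \<longleftrightarrow> projects T S \<and> F < dC S (b S) (pt T S)"

text \<open>In \<open>C S\<close> both \<open>y\<close> and \<open>b\<close> are far from
  \<open>pt T S\<close>, and they are close to each other, so consistency makes \<open>S\<close>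
  determine the coordinate at \<open>T\<close>. Contrapositively, a point far from \<open>b\<close>
  at \<open>T\<close> is far from \<open>b\<close> at \<open>S\<close>.\<close>

lemma misses_near:
  assumes b: "consistent \<kappa> b" "D \<le> \<kappa>" and TS: "misses F b T S" and y: "y \<in> X"
    and near: "dC S (\<pi> S y) (b S) < F - \<kappa>"
  shows "dC T (\<pi> T y) (b T) \<le> 2 * \<kappa>"
proof -
  have pr: "projects T S" and far: "F < dC S (b S) (pt T S)"
    using TS by (auto simp: misses_def)
  have S: "T \<in> \<SS>" "S \<in> \<SS>" using projects_in[OF pr] by auto
  interpret T: gromov_hyperbolic "C T" "dC T" D using gromov_hyperbolic_domain S by blast
  interpret S: gromov_hyperbolic "C S" "dC S" D using gromov_hyperbolic_domain S by blast
  have M: "\<pi> S y \<in> C S" "b S \<in> C S" "pt T S \<in> C S" "\<pi> T y \<in> C T" "b T \<in> C T"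
    using \<pi>_in y S consistentD(1)[OF b(1)] rho_props(4)[OF pr] by auto
  have y_far: "\<kappa> < dC S (\<pi> S y) (pt T S)"
    using S.triangle[of "b S" "\<pi> S y" "pt T S"] M S.commute[of "b S" "\<pi> S y"] near far by linarith
  have \<kappa>: "0 < \<kappa>" using b(2) D_ge by linarith
  show ?thesis
  proof (cases "trv T S")
    case True
    then have st: "pt S T \<in> C T"
      using rho_props(4)[of S T] trv_commute by (auto simp: projects_def)
    have "\<kappa> < F" using near S.nonneg[of "\<pi> S y" "b S"] by linarith
    then have "dC T (b T) (pt S T) \<le> \<kappa>" "dC T (\<pi> T y) (pt S T) \<le> D"
      using consistentD(2)[OF b(1) True] transverse_near[OF True y] far y_far b(2) by linarith+
    then show ?thesis
      using T.triangle[of "\<pi> T y" "pt S T" "b T"] M st T.commute[of "b T" "pt S T"] b(2) by linarith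
  next
    case False
    then have TS': "pnest T S" using pr by (auto simp: projects_def)
    have "\<kappa> < gp S (pt T S) (\<pi> S y) (b S)"
      using y_far far near gromov_product_double[of "dC S" "pt T S" "\<pi> S y" "b S"]
        S.commute[of "\<pi> S y" "pt T S"] S.commute[of "b S" "pt T S"]
        S.triangle[of "b S" "\<pi> S y" "pt T S"] M S.commute[of "b S" "\<pi> S y"] S.nonneg[of "\<pi> S y" "b S"] by linarith
    then show ?thesis
      using consistentD(3)[OF b(1) TS' y] \<kappa> by linarith
  qed
qed

text \<open>
  Otherwise there is an infinite sequence of domains in which \<open>x\<close> is far from \<open>b\<close>, each missed from
  the next. A point realising \<open>b\<close> at the \<open>k\<close>-th of them realises it at all earlier ones as well,
  so that its relevant domains with \<open>x\<close> outnumber what large links permits.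
\<close>

lemma exists_unmissed:
  assumes b: "consistent \<kappa> b" "D \<le> \<kappa>" and x: "x \<in> X" and R: "\<And>W. W \<in> \<SS> \<Longrightarrow> dC W (\<pi> W x) (b W) \<le> R"
    and K: "4 * \<kappa> \<le> K" and T0: "T0 \<in> \<SS>" "K < dC T0 (\<pi> T0 x) (b T0)"
  obtains T where "T \<in> \<SS>" "K < dC T (\<pi> T x) (b T)" "\<And>S. \<not> misses (K + 2 * \<kappa>) b T S"
proof (rule ccontr)
  assume none: "\<not> thesis"
  note unmissed = that
  let ?F = "K + 2 * \<kappa>"
  let ?bad = "\<lambda>T. T \<in> \<SS> \<and> K < dC T (\<pi> T x) (b T)"
  have \<kappa>: "0 < \<kappa>" "8 \<le> \<kappa>" "8 * E \<le> \<kappa>" using b(2) D_ge by linarith+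
  have "\<exists>S. ?bad S \<and> misses ?F b T S" if T: "?bad T" for T
  proof -
    obtain S where S: "misses ?F b T S" using none unmissed[of T] T by blast
    have "S \<in> \<SS>" using S projects_in by (auto simp: misses_def)
    \<comment> \<open>Distance above \<open>2 * \<kappa>\<close> at \<open>T\<close> forces at least
      \<open>?F - \<kappa> = K + \<kappa>\<close> at \<open>S\<close>, so nothing is lost along the
      sequence.\<close>
    moreover have "K < dC S (\<pi> S x) (b S)"
      using misses_near[OF b S x] T K \<kappa> by linarith
    ultimately show ?thesis using S by blast
  qed
  then obtain T where T: "\<And>n. ?bad (T n)" "\<And>n. misses ?F b (T n) (T (Suc n))"
    using dependent_nat_choice[of "\<lambda>_. ?bad" "\<lambda>_ T S. misses ?F b T S"] T0 by metis
  have TS: "T n \<in> \<SS>" for n using T(1) by auto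
  have bC: "b W \<in> C W" if "W \<in> \<SS>" for W using consistentD(1)[OF b(1) that] .
  have metT: "Metric_space (C W) (dC W)" if "W \<in> \<SS>" for W using metric_domain[OF that] .
  let ?near = "\<lambda>z n. dC (T n) (\<pi> (T n) z) (b (T n)) \<le> 2 * \<kappa>"
  have backward: "?near z j" if "z \<in> X" "?near z (j + i)" for z j i
    using that(2)
  proof (induction i)
    case (Suc i)
    then have "?near z (j + i)"
      using misses_near[OF b T(2)[of "j + i"] that(1)] K \<kappa> by simp
    then show ?case using Suc.IH by simp
  qed simp
  \<comment> \<open>A point realising \<open>b\<close> at \<open>T i\<close> is near
    \<open>pt (T i) (T (Suc i))\<close>, from which \<open>b\<close> is far.\<close>
  have far_next: "?F - \<kappa> \<le> dC (T (Suc i)) (\<pi> (T (Suc i)) z) (b (T (Suc i)))"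
    if "realises_on \<V> b z" "T i \<in> \<V>" for \<V> z i
  proof -
    let ?S = "T (Suc i)"
    interpret S: Metric_space "C ?S" "dC ?S" using metT TS .
    have pr: "projects (T i) ?S" and far: "?F < dC ?S (b ?S) (pt (T i) ?S)"
      using T(2)[of i] by (auto simp: misses_def)
    have "dC ?S (\<pi> ?S z) (pt (T i) ?S) \<le> D" using realises_onD(3)[OF that(1,2) pr] .
    moreover have "\<pi> ?S z \<in> C ?S" using \<pi>_in TS realises_onD(1)[OF that(1)] by blast
    ultimately show ?thesis
      using S.triangle[of "b ?S" "\<pi> ?S z" "pt (T i) ?S"] bC[OF TS, of "Suc i"] rho_props(4)[OF pr]
        S.commute[of "b ?S" "\<pi> ?S z"] far b(2) by linarith
  qed
  have not_near: "\<not> ?near z j" if "realises_on \<V> b z" "T i \<in> \<V>" "i < j" for \<V> z i j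
  proof
    assume "?near z j"
    then have "?near z (Suc i)"
      using backward[of z "Suc i" "j - Suc i"] realises_onD(1)[OF that(1)] that(3) by simp
    then show False
      using far_next[OF that(1,2)] K \<kappa> by linarith
  qed
  have far_later: "?F - \<kappa> \<le> dC (T j) (\<pi> (T j) z) (b (T j))"
    if z: "realises_on \<V> b z" "T i \<in> \<V>" "i < j" for \<V> z i j
  proof (cases "j = Suc i")
    case False
    then obtain m where m: "j = Suc m" "i < m" using z(3) by (cases j) auto
    have "\<not> ?near z m" using not_near[OF z(1,2) m(2)] .
    then show ?thesis
      using misses_near[OF b T(2)[of m] realises_onD(1)[OF z(1)]] m(1) by (meson not_le)
  qed (use far_next[OF z(1,2)] in simp)
  have real1: "\<exists>z. realises_on {T i} b z" for i
    using realises_on_exists[of "{T i}" b] TS bC by (metis empty_subsetI insert_subset pairwise_singleton singletonD)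
  have near_self: "?near z i" if "realises_on \<V> b z" "T i \<in> \<V>" for \<V> z i
    using realises_onD(2)[OF that] b(2) \<kappa> by linarith
  have distinct: "T i \<noteq> T j" if "i < j" for i j
  proof
    assume eq: "T i = T j"
    obtain z where z: "realises_on {T i} b z" using real1 by blast
    have "?near z i" using near_self[OF z] by simp
    then show False using not_near[OF z _ that] eq by simp
  qed
  have not_orth: "(T i, T j) \<notin> orth" if "i < j" for i j
  proof
    assume o: "(T i, T j) \<in> orth"
    obtain z where z: "realises_on {T i, T j} b z"
      by (rule realises_on_exists[of "{T i, T j}" b])
        (use TS bC o orth_commute in \<open>auto simp: pairwise_insert\<close>)
    have "?near z j" using near_self[OF z] by simp
    then show False using not_near[OF z _ that] by simp
  qed
  \<comment> \<open>The set \<open>{..k}\<close> has one element more than large links admits once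
    distances are bounded by \<open>R + 3 * \<kappa>\<close>.\<close>
  define k where "k = (nat \<lfloor>E * (R + 3 * \<kappa>) + E\<rfloor> + 1) ^ height"
  obtain y where y: "realises_on {T k} b y" using real1 by blast
  have yX: "y \<in> X" using realises_onD(1)[OF y] .
  have inj: "inj_on T {..k}"
    using distinct by (metis inj_onI linorder_neqE_nat)
  have large: "E \<le> dist_at S x y" if S: "S \<in> T ` {..k}" for S
  proof -
    obtain j where j: "S = T j" "j \<le> k" using S by auto
    interpret S: Metric_space "C S" "dC S" using metT TS j by blast
    have "?near y j" using backward[OF yX, of j "k - j"] near_self[OF y, of k] j(2) by simp
    then show ?thesis
      using S.triangle[of "\<pi> S x" "\<pi> S y" "b S"] \<pi>_in[OF TS x] \<pi>_in[OF TS yX] bC[OF TS] T(1)[of j] j K \<kappa> E_ge_1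
      by (smt (verit))
  qed
  \<comment> \<open>Above the \<open>T j\<close>, the coordinates of \<open>y\<close> are controlled
    through the relation of \<open>W\<close> to \<open>T k\<close>: either \<open>y\<close> is near
    \<open>b\<close> in \<open>W\<close>, or \<open>y\<close> is near \<open>pt (T k) W\<close>,
    which is at bounded distance from \<open>x\<close> because \<open>x\<close> and \<open>b\<close>
    differ at \<open>T k\<close>.\<close>
  have bounded: "dist_at W x y \<le> R + 3 * \<kappa>" if TW: "(T j, W) \<in> nest" and jk: "j \<le> k" for j W
  proof -
    have W: "W \<in> \<SS>" using TW nest_subset by blast
    interpret W: gromov_hyperbolic "C W" "dC W" D using gromov_hyperbolic_domain[OF W] .
    have M: "\<pi> W x \<in> C W" "\<pi> W y \<in> C W" "b W \<in> C W"
      using \<pi>_in W x yX bC by auto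
    note Rx = R[OF W]
    have via_b: ?thesis if "dC W (\<pi> W y) (b W) \<le> 3 * \<kappa>"
      using that Rx W.triangle[of "\<pi> W x" "b W" "\<pi> W y"] M W.commute[of "b W" "\<pi> W y"] by linarith
    have bad_k: "4 * \<kappa> < dC (T k) (\<pi> (T k) x) (b (T k))" using T(1)[of k] K by linarith
    interpret Tk: gromov_hyperbolic "C (T k)" "dC (T k)" D using gromov_hyperbolic_domain[OF TS] .
    have Mk: "\<pi> (T k) x \<in> C (T k)" "\<pi> (T k) y \<in> C (T k)" "b (T k) \<in> C (T k)"
      using \<pi>_in TS x yX bC by auto
    show ?thesis
      using W TS[of k]
    proof (cases rule: domain_cases)
      case 1
      then show ?thesis
        using near_self[OF y, of k] via_b \<kappa> by auto
    next
      case 2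
      then have W_nest: "(W, T k) \<in> nest" "W \<noteq> T k" by (auto simp: properly_nested_def)
      have "j \<noteq> k" using W_nest TW nest_antisym by blast
      then have j: "j < k" using jk by simp
      have pn: "pnest (T j) (T k)"
        using W_nest TW nest_trans distinct[OF j] by (auto simp: properly_nested_def)
      then have pr: "projects (T j) (T k)" by (simp add: projects_def)
      obtain z where z: "realises_on {T j} b z" using real1 by blast
      have zM: "\<pi> (T k) z \<in> C (T k)" using \<pi>_in TS realises_onD(1)[OF z] by blast
      let ?a = "pt (T j) (T k)" and ?w = "pt W (T k)"
      have aM: "?a \<in> C (T k)" "?w \<in> C (T k)"
        using rho_props(4) pr 2 by (auto simp: projects_def)
      \<comment> \<open>The point \<open>z\<close> is near \<open>?a\<close>, hence near
        \<open>?w\<close>, but far from \<open>b\<close>. So \<open>?w\<close> is far from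
        \<open>b\<close> and from \<open>y\<close>, which agree in \<open>C (T k)\<close>, and
        consistency carries the agreement down to \<open>W\<close>.\<close>
      have "?F - \<kappa> \<le> dC (T k) (\<pi> (T k) z) (b (T k))"
        using far_later[OF z _ j] by simp
      moreover have "dC (T k) (\<pi> (T k) z) ?a \<le> D"
        using realises_onD(3)[OF z _ pr] by simp
      moreover have "dC (T k) ?a ?w \<le> D"
        using nested_pt_near[OF TW 2] .
      ultimately have "?F - 3 * \<kappa> \<le> dC (T k) ?w (b (T k))"
        using Tk.triangle[OF zM aM(1) Mk(3)] Tk.triangle[OF aM(1) aM(2) Mk(3)] b(2) by linarith
      moreover have yb: "dC (T k) (\<pi> (T k) y) (b (T k)) \<le> D"
        using realises_onD(2)[OF y] by simp
      ultimately have "\<kappa> < gp (T k) ?w (\<pi> (T k) y) (b (T k))"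
        using gromov_product_double[of "dC (T k)" ?w "\<pi> (T k) y" "b (T k)"]
          Tk.triangle[OF aM(2) Mk(2,3)] b(2) K \<kappa> by linarith
      then have "dC W (\<pi> W y) (b W) \<le> \<kappa>"
        using consistentD(3)[OF b(1) 2 yX] by simp
      then show ?thesis using via_b \<kappa> by simp
    next
      case 3
      then have pr: "projects (T k) W" by (simp add: projects_def)
      let ?s = "pt (T k) W"
      have sM: "?s \<in> C W" using rho_props(4)[OF pr] .
      have ys: "dC W (\<pi> W y) ?s \<le> D" using realises_onD(3)[OF y _ pr] by simp
      \<comment> \<open>A large product would put \<open>x\<close> near \<open>b\<close> at
        \<open>T k\<close>.\<close>
      have "gp W ?s (\<pi> W x) (b W) \<le> \<kappa>"
        using consistentD(3)[OF b(1) 3 x] bad_k \<kappa> by linarith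
      then have "dC W (\<pi> W x) ?s \<le> R + 2 * \<kappa>"
        using gromov_product_double[of "dC W" ?s "\<pi> W x" "b W"] Rx W.nonneg[of ?s "b W"]
          W.commute[of ?s "\<pi> W x"] by linarith
      then show ?thesis
        using W.triangle[of "\<pi> W x" ?s "\<pi> W y"] M sM ys W.commute[of ?s "\<pi> W y"] b(2) by linarith
    next
      case 4
      then have trv': "trv (T k) W" using trv_commute by blast
      then have pr: "projects (T k) W" "projects W (T k)" using 4 by (auto simp: projects_def)
      let ?s = "pt (T k) W" and ?t = "pt W (T k)"
      have sM: "?s \<in> C W" "?t \<in> C (T k)" using rho_props(4) pr by auto
      have ys: "dC W (\<pi> W y) ?s \<le> D" using realises_onD(3)[OF y _ pr(1)] by simp
      have "dC W (\<pi> W x) ?s \<le> D \<or> dC W (b W) ?s \<le> \<kappa>"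
      proof (rule ccontr)
        assume "\<not> ?thesis"
        then have "dC (T k) (\<pi> (T k) x) ?t \<le> D" "dC (T k) (b (T k)) ?t \<le> \<kappa>"
          using transverse_near[OF trv' x] consistentD(2)[OF b(1) trv'] by auto
        then show False
          using Tk.triangle[OF Mk(1) sM(2) Mk(3)] Tk.commute[of ?t "b (T k)"] bad_k b(2) \<kappa> by linarith
      qed
      then have "dC W (\<pi> W x) ?s \<le> R + \<kappa>"
        using W.triangle[of "\<pi> W x" "b W" ?s] M sM Rx b(2) W.nonneg[of "\<pi> W x" "b W"] \<kappa> by linarith
      then show ?thesis
        using W.triangle[of "\<pi> W x" ?s "\<pi> W y"] M sM ys W.commute[of ?s "\<pi> W y"] b(2) \<kappa> by linarith
    next
      case 5
      then have o: "(T j, T k) \<in> orth" using orth_nest[OF TW] by blast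
      then have "j \<noteq> k" using orth_irrefl by (auto simp: irrefl_def)
      then have "j < k" using jk by simp
      then show ?thesis using o not_orth by blast
    qed
  qed
  have "card (T ` {..k}) \<le> (nat \<lfloor>E * (R + 3 * \<kappa>) + E\<rfloor> + 1) ^ height"
  proof (rule large_links_count[OF x yX])
    show "T ` {..k} \<subseteq> \<SS>" using TS by blast
  qed (use large bounded in auto)
  then show False
    using card_image[OF inj] by (simp add: k_def)
qed

lemma orth_family_colevel_sum:
  assumes "finite \<V>" "pairwise (\<lambda>U V. (U, V) \<in> orth) \<V>" "\<V> \<subseteq> \<SS>"
  shows "(\<Sum>V\<in>\<V>. colevel V) \<le> height * height"
proof (cases "\<V> = {}")
  case False
  then obtain M where M: "M \<in> \<SS>" "\<And>T. T \<in> \<SS> \<Longrightarrow> (T, M) \<in> nest"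
    using top_exists assms(3) by blast
  have "card \<V> + colevel M \<le> height + 1"
    using orth_family_card[OF assms(1,2), of M] M(2) assms(3) by blast
  then have "card \<V> \<le> height"
    using colevel_pos[OF M(1)] by linarith
  moreover have "(\<Sum>V\<in>\<V>. colevel V) \<le> card \<V> * height"
    using sum_bounded_above[of \<V> colevel height] colevel_le_height by simp
  ultimately show ?thesis
    by (meson le_trans mult_le_mono1)
qed simp

text \<open>
  If a point realising \<open>b\<close> over \<open>\<V>\<close> is far from \<open>b\<close> in some domain, such a domain that is moreover
  not missed from anywhere can be added to \<open>\<V>\<close> or refine one of its members. Either move increases
  the total colevel, which is bounded.
\<close>

lemma extend_orth_family:
  assumes b: "consistent \<kappa> b" "D \<le> \<kappa>" and x0: "x0 \<in> X" and R: "\<And>W. W \<in> \<SS> \<Longrightarrow> dC W (\<pi> W x0) (b W) \<le> R"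
    and \<V>: "finite \<V>" "pairwise (\<lambda>U V. (U, V) \<in> orth) \<V>" "\<V> \<subseteq> \<SS>"
    and F: "3 * \<kappa> \<le> F" "\<And>V W. V \<in> \<V> \<Longrightarrow> \<not> misses F b V W"
    and far: "\<And>z. z \<in> X \<Longrightarrow> \<exists>W\<in>\<SS>. F + \<kappa> < dC W (\<pi> W z) (b W)"
  obtains \<V>' where "finite \<V>'" "pairwise (\<lambda>U V. (U, V) \<in> orth) \<V>'" "\<V>' \<subseteq> \<SS>"
    "\<And>V W. V \<in> \<V>' \<Longrightarrow> \<not> misses (F + 3 * \<kappa>) b V W"
    "(\<Sum>V\<in>\<V>. colevel V) < (\<Sum>V\<in>\<V>'. colevel V)"
proof -
  have \<kappa>: "0 < \<kappa>" using b(2) D_ge by linarith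
  have bC: "b W \<in> C W" if "W \<in> \<SS>" for W using consistentD(1)[OF b(1) that] .
  obtain x where x: "realises_on \<V> b x"
    by (rule realises_on_exists[OF \<V>(3,2)]) (use bC \<V>(3) in auto)
  have xX: "x \<in> X" using realises_onD(1)[OF x] .
  have Rx: "dC W (\<pi> W x) (b W) \<le> E * d x x0 + E + R" if W: "W \<in> \<SS>" for W
  proof -
    interpret W: Metric_space "C W" "dC W" using metric_domain[OF W] .
    show ?thesis
      using W.triangle[of "\<pi> W x" "\<pi> W x0" "b W"] \<pi>_in[OF W] xX x0 bC[OF W] R[OF W]
        proj_coarsely_Lipschitz[OF W xX x0] by auto
  qed
  obtain T0 where T0: "T0 \<in> \<SS>" "F + \<kappa> < dC T0 (\<pi> T0 x) (b T0)"
    using far[OF xX] by auto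
  obtain T where T: "T \<in> \<SS>" "F + \<kappa> < dC T (\<pi> T x) (b T)" "\<And>S. \<not> misses (F + \<kappa> + 2 * \<kappa>) b T S"
    using exists_unmissed[OF b xX Rx _ T0] F(1) by auto
  have T_notin: "T \<notin> \<V>"
    using realises_onD(2)[OF x, of T] T(2) F(1) b(2) \<kappa> by auto
  \<comment> \<open>At \<open>T\<close> the point \<open>x\<close> is near \<open>pt V T\<close>
    because it realises \<open>V\<close>, and \<open>b\<close> is near it because \<open>V\<close>
    is not missed; but \<open>x\<close> is far from \<open>b\<close> there.\<close>
  have not_proj: "\<not> projects V T" if V: "V \<in> \<V>" for V
  proof
    assume pr: "projects V T"
    interpret T: Metric_space "C T" "dC T" using metric_domain[OF T(1)] .
    have "dC T (b T) (pt V T) \<le> F"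
      using F(2)[OF V, of T] pr by (auto simp: misses_def)
    then show False
      using realises_onD(3)[OF x V pr] T(2) b(2) T.triangle[of "\<pi> T x" "pt V T" "b T"]
        \<pi>_in[OF T(1) xX] rho_props(4)[OF pr] bC[OF T(1)] T.commute[of "b T" "pt V T"] by linarith
  qed
  define \<A> where "\<A> = {V \<in> \<V>. pnest T V}"
  have rest: "(T, V) \<in> orth" if "V \<in> \<V> - \<A>" for V
  proof -
    have V: "V \<in> \<SS>" "V \<in> \<V>" using that \<V>(3) by auto
    show ?thesis
      by (rule domain_cases[OF T(1) V(1)])
        (use not_proj[OF V(2)] that T_notin trv_commute in \<open>auto simp: \<A>_def projects_def\<close>)
  qed
  \<comment> \<open>A domain nested in two orthogonal ones would be orthogonal to one that contains
    it.\<close>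
  have \<A>_eq: "V = V'" if "V \<in> \<A>" "V' \<in> \<A>" for V V'
  proof (rule ccontr)
    assume "V \<noteq> V'"
    then have "(V, V') \<in> orth"
      using that \<V>(2) by (auto simp: \<A>_def pairwise_def)
    then have "(T, V') \<in> orth"
      using orth_nest that(1) by (auto simp: \<A>_def properly_nested_def)
    then show False
      using orth_not_comparable that(2) by (auto simp: \<A>_def properly_nested_def)
  qed
  have sum_\<A>: "(\<Sum>V\<in>\<A>. colevel V) < colevel T"
  proof (cases "\<A> = {}")
    case False
    then obtain V where V: "V \<in> \<A>" by auto
    then have "\<A> = {V}" using \<A>_eq by auto
    then show ?thesis
      using V colevel_less by (auto simp: \<A>_def)
  qed (use colevel_pos[OF T(1)] in simp)
  have fin: "finite \<A>" using \<V>(1) by (simp add: \<A>_def)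
  have sub: "\<A> \<subseteq> \<V>" by (auto simp: \<A>_def)
  let ?V = "insert T (\<V> - \<A>)"
  show thesis
  proof (rule that[of ?V])
    show "finite ?V" using \<V>(1) by simp
    show "pairwise (\<lambda>U V. (U, V) \<in> orth) ?V"
      using \<V>(2) rest orth_commute by (auto simp: pairwise_insert pairwise_def)
    show "?V \<subseteq> \<SS>" using \<V>(3) T(1) by auto
    show "\<not> misses (F + 3 * \<kappa>) b V W" if "V \<in> ?V" for V W
    proof (cases "V = T")
      case True
      then show ?thesis using T(3)[of W] by (simp add: algebra_simps)
    next
      case False
      then have "\<not> misses F b V W" using that F(2) by auto
      then show ?thesis using \<kappa> by (auto simp: misses_def)
    qed
    have "(\<Sum>V\<in>\<V>. colevel V) = (\<Sum>V\<in>\<V> - \<A>. colevel V) + (\<Sum>V\<in>\<A>. colevel V)"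
      using sum.subset_diff[OF sub \<V>(1)] .
    then show "(\<Sum>V\<in>\<V>. colevel V) < (\<Sum>V\<in>?V. colevel V)"
      using sum_\<A> \<V>(1) T_notin by simp
  qed
qed

text \<open>\<open>m\<close> is the total colevel still to be gained, so at most \<open>m\<close>
  extensions are possible, each at the price \<open>3 * \<kappa>\<close>.\<close>

lemma realisation_above:
  assumes b: "consistent \<kappa> b" "D \<le> \<kappa>" and x0: "x0 \<in> X" and R: "\<And>W. W \<in> \<SS> \<Longrightarrow> dC W (\<pi> W x0) (b W) \<le> R"
    and "finite \<V>" "pairwise (\<lambda>U V. (U, V) \<in> orth) \<V>" "\<V> \<subseteq> \<SS>" "3 * \<kappa> \<le> F"
      "\<And>V W. V \<in> \<V> \<Longrightarrow> \<not> misses F b V W" "height * height \<le> m + (\<Sum>V\<in>\<V>. colevel V)"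
  shows "\<exists>z\<in>X. \<forall>W\<in>\<SS>. dC W (\<pi> W z) (b W) \<le> F + \<kappa> + 3 * real m * \<kappa>"
  using assms(5-)
proof (induction m arbitrary: F \<V>)
  case (0 F \<V>)
  show ?case
  proof (rule ccontr)
    assume "\<not> ?case"
    then have far: "\<exists>W\<in>\<SS>. F + \<kappa> < dC W (\<pi> W z) (b W)" if "z \<in> X" for z
      using that by (auto simp: not_le)
    show False
      by (rule extend_orth_family[OF b x0 R 0(1-5) far]) (use 0(6) orth_family_colevel_sum in fastforce)+
  qed
next
  case (Suc m F \<V>)
  have \<kappa>: "0 < \<kappa>" using b(2) D_ge by linarith
  have bound: "F + 3 * \<kappa> + \<kappa> + 3 * real m * \<kappa> = F + \<kappa> + 3 * real (Suc m) * \<kappa>"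
    by (simp add: algebra_simps)
  show ?case
  proof (cases "\<exists>z\<in>X. \<forall>W\<in>\<SS>. dC W (\<pi> W z) (b W) \<le> F + \<kappa>")
    case True
    moreover have "0 \<le> 3 * real (Suc m) * \<kappa>" using \<kappa> by simp
    ultimately show ?thesis
      by (smt (verit))
  next
    case False
    then have far: "\<exists>W\<in>\<SS>. F + \<kappa> < dC W (\<pi> W z) (b W)" if "z \<in> X" for z
      using that by (auto simp: not_le)
    obtain \<V>' where \<V>': "finite \<V>'" "pairwise (\<lambda>U V. (U, V) \<in> orth) \<V>'" "\<V>' \<subseteq> \<SS>"
      "\<And>V W. V \<in> \<V>' \<Longrightarrow> \<not> misses (F + 3 * \<kappa>) b V W"
      "(\<Sum>V\<in>\<V>. colevel V) < (\<Sum>V\<in>\<V>'. colevel V)"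
      using extend_orth_family[OF b x0 R Suc.prems(1-5) far] by blast
    show ?thesis
      using Suc.IH[OF \<V>'(1-3) _ \<V>'(4)] \<V>'(5) Suc.prems(4,6) \<kappa> unfolding bound by simp
  qed
qed

theorem realisation:
  assumes b: "consistent \<kappa> b" "D \<le> \<kappa>" and x0: "x0 \<in> X" and R: "\<And>W. W \<in> \<SS> \<Longrightarrow> dC W (\<pi> W x0) (b W) \<le> R"
  obtains z where "z \<in> X" "\<And>W. W \<in> \<SS> \<Longrightarrow> dC W (\<pi> W z) (b W) \<le> (4 + 3 * real (height * height)) * \<kappa>"
proof -
  have "\<exists>z\<in>X. \<forall>W\<in>\<SS>. dC W (\<pi> W z) (b W) \<le> 3 * \<kappa> + \<kappa> + 3 * real (height * height) * \<kappa>"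
    using realisation_above[OF b x0 R, of "{}" "3 * \<kappa>" "height * height"] by simp
  then show thesis
    using that by (auto simp: algebra_simps)
qed

section \<open>The coarse Helly property of the whole space\<close>

definition Helly_constant :: real where
  "Helly_constant = (4 + 3 * real (height * height)) * (15 * D) + 9 * D"

text \<open>\<open>R\<close> is only required to exist: realisation needs a tuple at bounded
  distance from one point, but its error is independent of that bound.\<close>

theorem coarse_Helly:
  assumes sub: "\<And>H. H \<in> \<H> \<Longrightarrow> H \<subseteq> X" and ne: "\<H> \<noteq> {}"
    and meet: "\<And>H K. H \<in> \<H> \<Longrightarrow> K \<in> \<H> \<Longrightarrow> H \<inter> K \<noteq> {}"
    and x: "x \<in> X" and near: "\<And>H. H \<in> \<H> \<Longrightarrow> \<exists>h\<in>H. d x h \<le> R"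
  obtains z where "z \<in> X" "\<And>U H. U \<in> \<SS> \<Longrightarrow> H \<in> \<H> \<Longrightarrow> \<exists>q\<in>hull_at U H. dC U (\<pi> U z) q \<le> Helly_constant"
proof -
  obtain p where p: "consistent (15 * D) p"
    "\<And>U. U \<in> \<SS> \<Longrightarrow> dC U (\<pi> U x) (p U) \<le> E * R + E + D"
    "\<And>U H. U \<in> \<SS> \<Longrightarrow> H \<in> \<H> \<Longrightarrow> \<exists>q\<in>hull_at U H. dC U (p U) q \<le> 9 * D"
    using Helly_tuple[OF assms] by blast
  have "D \<le> 15 * D" using D_ge by linarith
  then obtain z where z: "z \<in> X"
    "\<And>W. W \<in> \<SS> \<Longrightarrow> dC W (\<pi> W z) (p W) \<le> (4 + 3 * real (height * height)) * (15 * D)"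
    using realisation[OF p(1) _ x p(2)] by blast
  show thesis
  proof (rule that[OF z(1)])
    fix U H assume U: "U \<in> \<SS>" and H: "H \<in> \<H>"
    interpret U: Metric_space "C U" "dC U" using metric_domain[OF U] .
    obtain q where q: "q \<in> hull_at U H" "dC U (p U) q \<le> 9 * D"
      using p(3)[OF U H] by blast
    then have "dC U (\<pi> U z) q \<le> Helly_constant"
      using z(2)[OF U] U.triangle[of "\<pi> U z" "p U" q] \<pi>_in[OF U z(1)] consistentD(1)[OF p(1) U]
      by (auto simp: Helly_constant_def geodesic_hull_def)
    then show "\<exists>q\<in>hull_at U H. dC U (\<pi> U z) q \<le> Helly_constant"
      using q(1) by blast
  qed
qed


section \<open>Chains of walls\<close>

text \<open>Quasigeodesics sampled at integer times, and constant once the end is reached.\<close>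

lemma coarse_paths:
  obtains K where "0 < K" "\<And>x y. x \<in> X \<Longrightarrow> y \<in> X \<Longrightarrow> \<exists>m f. real m \<le> K * d x y + K \<and> f 0 = x \<and> f m = y \<and>
    (\<forall>i. f i \<in> X) \<and> (\<forall>i. d (f i) (f (Suc i)) \<le> K)"
proof -
  obtain K L where KL: "K \<ge> 1" "L \<ge> 0" "\<forall>x\<in>X. \<forall>y\<in>X. \<exists>T\<ge>0. \<exists>q::real \<Rightarrow> 'x.
      q 0 = x \<and> q T = y \<and> quasi_isometric_embedding K L {0..T} dist X d q"
    using quasigeodesic unfolding quasigeodesic_space_def by blast
  define K' where "K' = K + K * L + L + 1"
  have K': "K \<le> K'" "K * L + 1 \<le> K'" "K + L \<le> K'" "0 < K'"
    using KL(1,2) mult_nonneg_nonneg[of K L] unfolding K'_def by linarith+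
  show thesis
  proof (rule that[OF K'(4)])
    fix x y assume xy: "x \<in> X" "y \<in> X"
    obtain T :: real and q where T: "0 \<le> T"
      and q: "q 0 = x" "q T = y" "quasi_isometric_embedding K L {0..T} dist X d q"
      using KL(3) xy by blast
    have qX: "q s \<in> X" if "s \<in> {0..T}" for s
      using q(3) that by (auto simp: quasi_isometric_embedding_def)
    have q_le: "dist s t / K - L \<le> d (q s) (q t)" "d (q s) (q t) \<le> K * dist s t + L"
      if "s \<in> {0..T}" "t \<in> {0..T}" for s t
      using q(3) that by (auto simp: quasi_isometric_embedding_def)
    define m where "m = nat \<lceil>T\<rceil>"
    define f where "f i = q (min (real i) T)" for i
    have dom: "min (real i) T \<in> {0..T}" for i using T by auto
    have Tm: "T \<le> real m" "real m \<le> T + 1"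
      using T of_int_ceiling_le_add_one[of T] by (auto simp: m_def real_nat_ceiling_ge)
    have "T / K - L \<le> d x y"
      using q_le(1)[of 0 T] T q by (auto simp: dist_real_def)
    then have "T \<le> K * (d x y + L)"
      using KL(1) by (simp add: field_simps)
    then have "real m \<le> K * d x y + (K * L + 1)"
      using Tm by (simp add: algebra_simps)
    also have "\<dots> \<le> K' * d x y + K'"
      using K' by (intro add_mono mult_right_mono) auto
    finally have "real m \<le> K' * d x y + K'" .
    moreover have "d (f i) (f (Suc i)) \<le> K'" for i
    proof -
      have "dist (min (real i) T) (min (real (Suc i)) T) \<le> 1"
        by (auto simp: dist_real_def)
      then have "K * dist (min (real i) T) (min (real (Suc i)) T) \<le> K * 1"
        using KL(1) by (intro mult_left_mono) auto
      then show ?thesis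
        using q_le(2)[OF dom dom, of i "Suc i"] K' by (simp add: f_def)
    qed
    moreover have "f 0 = x" "f m = y" "\<forall>i. f i \<in> X"
      using T q qX[OF dom] Tm by (auto simp: f_def min_absorb2)
    ultimately show "\<exists>m f. real m \<le> K' * d x y + K' \<and> f 0 = x \<and> f m = y \<and>
      (\<forall>i. f i \<in> X) \<and> (\<forall>i. d (f i) (f (Suc i)) \<le> K')"
      by blast
  qed
qed

definition step :: real where
  "step = (SOME K. 0 < K \<and> (\<forall>x\<in>X. \<forall>y\<in>X. \<exists>m f. real m \<le> K * d x y + K \<and> f 0 = x \<and> f m = y \<and>
    (\<forall>i. f i \<in> X) \<and> (\<forall>i. d (f i) (f (Suc i)) \<le> K)))"

lemma step:
  shows "0 < step" "x \<in> X \<Longrightarrow> y \<in> X \<Longrightarrow> \<exists>m f. real m \<le> step * d x y + step \<and> f 0 = x \<and> f m = y \<and>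
    (\<forall>i. f i \<in> X) \<and> (\<forall>i. d (f i) (f (Suc i)) \<le> step)"
proof -
  have "\<exists>K. 0 < K \<and> (\<forall>x\<in>X. \<forall>y\<in>X. \<exists>m f. real m \<le> K * d x y + K \<and> f 0 = x \<and> f m = y \<and>
    (\<forall>i. f i \<in> X) \<and> (\<forall>i. d (f i) (f (Suc i)) \<le> K))"
    using coarse_paths by metis
  from someI_ex[OF this] show "0 < step" "x \<in> X \<Longrightarrow> y \<in> X \<Longrightarrow> \<exists>m f. real m \<le> step * d x y + step \<and>
      f 0 = x \<and> f m = y \<and> (\<forall>i. f i \<in> X) \<and> (\<forall>i. d (f i) (f (Suc i)) \<le> step)"
    unfolding step_def by blast+
qed

text \<open>Two demands on the gap: above \<open>Helly_constant + D / 2\<close>, so that nearness to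
  hulls cannot cross a wall, and above \<open>E * step + E\<close>, so that a step of a coarse path
  cannot.\<close>

definition thickness :: real where
  "thickness = Helly_constant + D + E * step + E"

lemma Helly_constant_nonneg: "0 \<le> Helly_constant"
  using D_ge by (simp add: Helly_constant_def)

lemma thickness_greater: "0 < thickness" "Helly_constant + D / 2 < thickness" "E * step + E < thickness"
proof -
  have "0 < E * step" using E_ge_1 step(1) by simp
  then show "0 < thickness" "Helly_constant + D / 2 < thickness" "E * step + E < thickness"
    using Helly_constant_nonneg D_ge E_ge_1 unfolding thickness_def by linarith+
qed

text \<open>\<open>gp U p (\<pi> U z) q\<close> is the coordinate of \<open>z\<close> along a
  geodesic from \<open>p\<close> to \<open>q\<close>; exchanging \<open>p\<close> and
  \<open>q\<close> reverses it.\<close>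

definition wall :: "'x set \<Rightarrow> 'x set \<Rightarrow> bool" where
  "wall A B \<longleftrightarrow> (\<exists>U\<in>\<SS>. \<exists>p\<in>C U. \<exists>q\<in>C U. \<exists>t. A = {z \<in> X. gp U p (\<pi> U z) q \<le> t} \<and>
     B = {z \<in> X. t + thickness \<le> gp U p (\<pi> U z) q})"

lemma wallE:
  assumes "wall A B"
  obtains U p q t where "U \<in> \<SS>" "p \<in> C U" "q \<in> C U" "A = {z \<in> X. gp U p (\<pi> U z) q \<le> t}"
    "B = {z \<in> X. t + thickness \<le> gp U p (\<pi> U z) q}"
  using assms by (auto simp: wall_def)

lemma wall_subset: "wall A B \<Longrightarrow> A \<subseteq> X" "wall A B \<Longrightarrow> B \<subseteq> X"
  by (auto simp: wall_def)

lemma wall_swap: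
  assumes "wall A B"
  shows "wall B A"
proof -
  obtain U p q t where w: "U \<in> \<SS>" "p \<in> C U" "q \<in> C U" "A = {z \<in> X. gp U p (\<pi> U z) q \<le> t}"
    "B = {z \<in> X. t + thickness \<le> gp U p (\<pi> U z) q}"
    using wallE[OF assms] .
  interpret U: Metric_space "C U" "dC U" using metric_domain w(1) .
  have "gp U q (\<pi> U z) p = dC U p q - gp U p (\<pi> U z) q" for z
    using gromov_product_double[of "dC U" q "\<pi> U z" p] gromov_product_double[of "dC U" p "\<pi> U z" q]
      U.commute[of p q] U.commute[of p "\<pi> U z"] U.commute[of q "\<pi> U z"] by linarith
  then have "B = {z \<in> X. gp U q (\<pi> U z) p \<le> dC U p q - t - thickness}"
    "A = {z \<in> X. dC U p q - t - thickness + thickness \<le> gp U q (\<pi> U z) p}"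
    using w(4,5) by auto
  then show ?thesis
    using w(1-3) unfolding wall_def by blast
qed

lemma wall_thick:
  assumes w: "wall A B" and x: "x \<in> A" and y: "y \<in> B"
  shows "step < d x y"
proof (rule ccontr)
  assume near: "\<not> step < d x y"
  obtain U p q t where w: "U \<in> \<SS>" "p \<in> C U" "q \<in> C U" "A = {z \<in> X. gp U p (\<pi> U z) q \<le> t}"
    "B = {z \<in> X. t + thickness \<le> gp U p (\<pi> U z) q}"
    using wallE[OF assms(1)] .
  interpret U: gromov_hyperbolic "C U" "dC U" D using gromov_hyperbolic_domain w(1) .
  have X: "x \<in> X" "y \<in> X" using x y w by auto
  have "E * d x y \<le> E * step" using near E_ge_1 by (intro mult_left_mono) auto
  then have "dist_at U y x < thickness"
    using proj_coarsely_Lipschitz[OF w(1) X] thickness_greater(3) U.commute[of "\<pi> U x" "\<pi> U y"] by linarith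
  moreover have "gp U p q (\<pi> U y) \<le> gp U p q (\<pi> U x) + dist_at U y x"
    using U.gp_lipschitz w(2,3) \<pi>_in[OF w(1)] X by blast
  ultimately show False
    using x y w(4,5) U.gp_commute[of p q "\<pi> U x"] U.gp_commute[of p q "\<pi> U y"] by auto
qed

lemma wall_not_in_both: "wall A B \<Longrightarrow> x \<in> A \<Longrightarrow> x \<notin> B"
  using wall_thick[of A B x x] step(1) wall_subset by fastforce

lemma wall_hull:
  assumes w: "wall A B" and H: "H \<subseteq> A" and z: "z \<in> X"
    "\<And>U. U \<in> \<SS> \<Longrightarrow> \<exists>q\<in>hull_at U H. dC U (\<pi> U z) q \<le> Helly_constant"
  shows "z \<notin> B"
proof -
  obtain U p q t where w: "U \<in> \<SS>" "p \<in> C U" "q \<in> C U" "A = {z \<in> X. gp U p (\<pi> U z) q \<le> t}"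
    "B = {z \<in> X. t + thickness \<le> gp U p (\<pi> U z) q}"
    using wallE[OF w] .
  interpret U: gromov_hyperbolic "C U" "dC U" D using gromov_hyperbolic_domain w(1) .
  obtain c where c: "c \<in> hull_at U H" "dC U (\<pi> U z) c \<le> Helly_constant"
    using z(2)[OF w(1)] by blast
  have "gp U p (\<pi> U z) q \<le> t + D / 2 + Helly_constant"
  proof (rule U.gp_le_of_hull[OF _ w(2,3) _ _ c])
    show "\<pi> U ` H \<subseteq> C U" using H w(4) \<pi>_in[OF w(1)] by auto
    show "gp U p a q \<le> t" if "a \<in> \<pi> U ` H" for a using that H w(4) by auto
    show "\<pi> U z \<in> C U" using \<pi>_in w(1) z(1) .
  qed
  then show ?thesis
    using w(5) thickness_greater(2) by auto
qed

text \<open>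
  \<open>front x n B\<close>: there are \<open>n\<close> walls \<open>(A\<^sub>1, B\<^sub>1), \<dots>, (A\<^sub>n, B\<^sub>n)\<close> with \<open>x \<in> A\<^sub>1\<close> and \<open>B\<^sub>n = B\<close>
  such that the complement of \<open>A\<^sub>i\<^sub>+\<^sub>1\<close> lies in \<open>B\<^sub>i\<close>.
\<close>

inductive front :: "'x \<Rightarrow> nat \<Rightarrow> 'x set \<Rightarrow> bool" for x where
  front_first: "wall A B \<Longrightarrow> x \<in> A \<Longrightarrow> front x (Suc 0) B"
| front_next: "front x n B \<Longrightarrow> wall A' B' \<Longrightarrow> X \<subseteq> B \<union> A' \<Longrightarrow> front x (Suc n) B'"

definition separated :: "nat \<Rightarrow> 'x \<Rightarrow> 'x \<Rightarrow> bool" where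
  "separated n x y \<longleftrightarrow> n = 0 \<or> (\<exists>B. front x n B \<and> y \<in> B)"

lemma front_subset: "front x n B \<Longrightarrow> B \<subseteq> X"
  by (induction rule: front.induct) (auto dest: wall_subset)

lemma front_pos: "front x n B \<Longrightarrow> 0 < n"
  by (induction rule: front.induct) auto

lemma front_SucE:
  assumes "front x (Suc n) B" "0 < n"
  obtains A B0 where "front x n B0" "wall A B" "X \<subseteq> B0 \<union> A"
  using assms by (cases rule: front.cases) auto

lemma front_OneE:
  assumes "front x (Suc 0) B"
  obtains A where "wall A B" "x \<in> A"
  using assms front_pos by (cases rule: front.cases) auto

text \<open>\<open>z\<close> is too near \<open>y\<close> to lie in the near side of the last wall,
  so it is behind the previous one: a step undoes at most one wall.\<close>

lemma separated_step:
  assumes sep: "separated (Suc n) x y" and z: "z \<in> X" "d z y \<le> step"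
  shows "separated n x z"
proof (cases "n = 0")
  case False
  obtain B where B: "front x (Suc n) B" "y \<in> B"
    using sep by (auto simp: separated_def)
  obtain A B0 where A: "front x n B0" "wall A B" "X \<subseteq> B0 \<union> A"
    using front_SucE[OF B(1)] False by blast
  have "z \<notin> A" using wall_thick[OF A(2) _ B(2), of z] z(2) by auto
  then show ?thesis
    using A z(1) by (auto simp: separated_def)
qed (simp add: separated_def)

lemma separated_pred:
  assumes "separated (Suc n) x y"
  shows "separated n x y"
proof -
  have "y \<in> X" using assms front_subset by (auto simp: separated_def)
  then show ?thesis
    using separated_step[OF assms] step(1) by simp
qed

lemma separated_mono: "separated n x y \<Longrightarrow> m \<le> n \<Longrightarrow> separated m x y"
  by (induction n) (auto simp: le_Suc_eq dest: separated_pred)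

lemma not_separated_self:
  assumes "0 < n"
  shows "\<not> separated n x x"
proof
  assume "separated n x x"
  then have "separated (Suc 0) x x" using assms separated_mono by (metis Suc_leI)
  then obtain B where "front x (Suc 0) B" "x \<in> B" by (auto simp: separated_def)
  then show False using front_OneE wall_not_in_both by metis
qed

lemma separated_path:
  assumes f: "\<And>i. f i \<in> X" "\<And>i. d (f i) (f (Suc i)) \<le> step" and "separated n (f 0) (f m)"
  shows "n \<le> m"
  using assms(3)
proof (induction m arbitrary: n)
  case 0
  then show ?case using not_separated_self by (metis not_gr_zero order_refl)
next
  case (Suc m)
  show ?case
  proof (cases n)
    case (Suc k)
    then have "separated k (f 0) (f m)"
      using separated_step[of k "f 0" "f (Suc m)" "f m"] Suc.prems f by blast
    then show ?thesis using Suc.IH Suc by auto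
  qed simp
qed

lemma separated_bound:
  assumes "x \<in> X" "y \<in> X" "separated n x y"
  shows "real n \<le> step * d x y + step"
proof -
  obtain m f where f: "real m \<le> step * d x y + step" "f 0 = x" "f m = y"
    "\<And>i. f i \<in> X" "\<And>i. d (f i) (f (Suc i)) \<le> step"
    using step(2)[OF assms(1,2)] by blast
  have "n \<le> m"
    using separated_path[of f n m] f assms(3) by blast
  then show ?thesis using f(1) by linarith
qed

section \<open>The separation number and its triangle inequality\<close>

definition separation :: "'x \<Rightarrow> 'x \<Rightarrow> nat" where
  "separation x y = Max {n. separated n x y}"

lemma separated_iff:
  assumes "x \<in> X" "y \<in> X"
  shows "separated n x y \<longleftrightarrow> n \<le> separation x y"
proof -
  have "n \<le> nat \<lfloor>step * d x y + step\<rfloor>" if "separated n x y" for n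
    using separated_bound[OF assms that] by (simp add: le_nat_floor)
  then have fin: "finite {n. separated n x y}"
    by (auto intro: finite_subset[of _ "{..nat \<lfloor>step * d x y + step\<rfloor>}"])
  have ne: "{n. separated n x y} \<noteq> {}"
    by (auto simp: separated_def intro: exI[of _ 0])
  have "separated (separation x y) x y"
    using Max_in[OF fin ne] by (simp add: separation_def)
  moreover have "n \<le> separation x y" if "separated n x y"
    using Max_ge[OF fin, of n] that by (simp add: separation_def)
  ultimately show ?thesis
    using separated_mono by blast
qed

text \<open>Reverse the chain issuing from \<open>y\<close> and append it.\<close>

lemma front_glue:
  assumes "front y m B'" "front x n B" "X \<subseteq> B \<union> B'"
  shows "separated (n + m) x y"
  using assms
proof (induction arbitrary: n B rule: front.induct)
  case (front_first A' B')
  then have "front x (Suc n) A'"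
    using wall_swap front_next by blast
  then show ?case
    using front_first by (auto simp: separated_def)
next
  case (front_next m B0 A' B')
  have "front x (Suc n) A'"
    using front.front_next[OF front_next(5) wall_swap[OF front_next(2)]] front_next(6) by blast
  then show ?case
    using front_next(4)[of "Suc n" A'] front_next(3) by auto
qed

lemma separated_swap:
  assumes "separated n x y"
  shows "separated n y x"
proof (cases n)
  case (Suc k)
  obtain B where B: "front x (Suc k) B" "y \<in> B"
    using assms Suc by (auto simp: separated_def)
  show ?thesis
  proof (cases "k = 0")
    case True
    then obtain A where "wall A B" "x \<in> A" using B front_OneE by metis
    then show ?thesis
      using B(2) wall_swap front_first True Suc unfolding separated_def by blast
  next
    case False
    then obtain A B0 where A: "front x k B0" "wall A B" "X \<subseteq> B0 \<union> A"
      using front_SucE[OF B(1)] by blast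
    have "front y (Suc 0) A"
      using wall_swap[OF A(2)] B(2) front_first by blast
    then show ?thesis
      using front_glue[OF A(1), of y "Suc 0" A] A(3) Suc by auto
  qed
qed (simp add: separated_def)

lemma separation_commute: "separation x y = separation y x"
proof -
  have "separated n x y \<longleftrightarrow> separated n y x" for n
    using separated_swap by blast
  then show ?thesis by (simp add: separation_def)
qed

text \<open>\<open>y\<close> is not behind wall \<open>k\<close>, so it lies in the near side of
  wall \<open>k + 1\<close>, and the rest of the chain issues from \<open>y\<close>.\<close>

lemma front_restart:
  assumes "front x (k + Suc j) B" "0 < k" "\<not> separated k x y" "y \<in> X"
  shows "front y (Suc j) B"
  using assms(1)
proof (induction j arbitrary: B)
  case 0
  then obtain A B0 where A: "front x k B0" "wall A B" "X \<subseteq> B0 \<union> A"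
    using front_SucE[of x k B] assms(2) by (metis add_Suc_right add_0_right)
  then have "y \<in> A" using assms(3,4) by (auto simp: separated_def)
  then show ?case using A(2) front_first by blast
next
  case (Suc j)
  then obtain A B0 where A: "front x (k + Suc j) B0" "wall A B" "X \<subseteq> B0 \<union> A"
    using front_SucE[of x "k + Suc j" B] by (metis add_Suc_right zero_less_Suc)
  then show ?case using Suc.IH front_next by blast
qed

text \<open>The chain is split after \<open>separation x y + 1\<close> walls, the least number that
  does not separate \<open>x\<close> from \<open>y\<close>; this is the additive 1.\<close>

lemma separation_triangle:
  assumes "x \<in> X" "y \<in> X" "z \<in> X"
  shows "separation x z \<le> separation x y + separation y z + 1"
proof (rule ccontr)
  assume less: "\<not> ?thesis"
  define k where "k = separation x y + 1"
  define j where "j = separation y z"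
  have "separated (k + Suc j) x z"
    using less separated_iff[OF assms(1,3)] by (simp add: k_def j_def)
  then obtain B where B: "front x (k + Suc j) B" "z \<in> B"
    by (auto simp: separated_def)
  have "\<not> separated k x y"
    using separated_iff[OF assms(1,2)] by (simp add: k_def)
  then have "front y (Suc j) B"
    using front_restart[OF B(1)] assms(2) by (simp add: k_def)
  then have "separated (Suc j) y z" using B(2) by (auto simp: separated_def)
  then show False using separated_iff[OF assms(2,3)] by (simp add: j_def)
qed

text \<open>A half-space about \<open>v\<close>: its complement lies behind a chain of
  \<open>k\<close> walls issuing from \<open>v\<close>.\<close>

definition cut :: "'x \<Rightarrow> nat \<Rightarrow> 'x set \<Rightarrow> bool" where
  "cut v k A \<longleftrightarrow> (\<exists>B0 B. front v k B0 \<and> wall A B \<and> X \<subseteq> B0 \<union> A)"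

lemma cut_subset: "cut v k A \<Longrightarrow> A \<subseteq> X"
  using wall_subset by (auto simp: cut_def)

lemma cut_contains:
  assumes "cut v k A" "y \<in> X" "\<not> separated k v y"
  shows "y \<in> A"
  using assms by (auto simp: cut_def separated_def)

lemma cut_contains_centre: "cut v k A \<Longrightarrow> v \<in> X \<Longrightarrow> v \<in> A"
  using cut_contains not_separated_self front_pos by (metis cut_def)

text \<open>In a chain of \<open>k + 1\<close> walls from \<open>v\<close> to \<open>z\<close> the
  near side of the last wall is a cut, and nearness to hulls inside it keeps \<open>z\<close> from
  the far side.\<close>

lemma separation_le_of_cuts:
  assumes "v \<in> X" "z \<in> X" "0 < k"
    and near: "\<And>A. cut v k A \<Longrightarrow> \<exists>H\<subseteq>A. \<forall>U\<in>\<SS>. \<exists>q\<in>hull_at U H. dC U (\<pi> U z) q \<le> Helly_constant"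
  shows "separation v z \<le> k"
proof (rule ccontr)
  assume "\<not> ?thesis"
  then have "separated (Suc k) v z" using separated_iff[OF assms(1,2)] by simp
  then obtain B where B: "front v (Suc k) B" "z \<in> B" by (auto simp: separated_def)
  obtain A B0 where A: "front v k B0" "wall A B" "X \<subseteq> B0 \<union> A"
    using front_SucE[OF B(1) assms(3)] .
  then have "cut v k A" by (auto simp: cut_def)
  then obtain H where "H \<subseteq> A" "\<forall>U\<in>\<SS>. \<exists>q\<in>hull_at U H. dC U (\<pi> U z) q \<le> Helly_constant"
    using near by blast
  then show False using wall_hull[OF A(2) _ assms(2)] B(2) by blast
qed

text \<open>Cuts about \<open>x\<close> all contain \<open>x\<close>, and likewise for
  \<open>y\<close>. A cut about \<open>x\<close> disjoint from one about \<open>y\<close> would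
  allow gluing the chains into \<open>n + m + 2\<close> walls between \<open>x\<close> and
  \<open>y\<close>.\<close>

lemma rough_interpolation:
  assumes x: "x \<in> X" and y: "y \<in> X" and le: "separation x y \<le> n + m"
  obtains z where "z \<in> X" "separation x z \<le> n + 1" "separation y z \<le> m + 1"
proof -
  \<comment> \<open>\<open>X\<close> keeps the family nonempty when there are no cuts. The lengths
    \<open>n + 1\<close> and \<open>m + 1\<close> are positive, as a chain has at least one
    wall.\<close>
  define \<H> where "\<H> = insert X ({A. cut x (n + 1) A} \<union> {A. cut y (m + 1) A})"
  have sub: "H \<subseteq> X" if "H \<in> \<H>" for H
    using that cut_subset by (auto simp: \<H>_def)
  have cross: "A \<inter> A' \<noteq> {}" if AA': "cut x (n + 1) A" "cut y (m + 1) A'" for A A'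
  proof
    assume disj: "A \<inter> A' = {}"
    obtain B B' where B: "front x (n + 1) B" "X \<subseteq> B \<union> A" "front y (m + 1) B'" "X \<subseteq> B' \<union> A'"
      using AA' by (auto simp: cut_def)
    then have "X \<subseteq> B \<union> B'" using disj by blast
    then have "separated (n + 1 + (m + 1)) x y"
      using front_glue[OF B(3,1)] by blast
    then show False using separated_iff[OF x y] le by simp
  qed
  have centre: "\<And>A. cut x (n + 1) A \<Longrightarrow> x \<in> A" "\<And>A. cut y (m + 1) A \<Longrightarrow> y \<in> A"
    using cut_contains_centre x y by blast+
  have touch: "x \<in> H \<or> y \<in> H" if "H \<in> \<H>" for H
    using that centre x unfolding \<H>_def by blast
  have meet: "H \<inter> K \<noteq> {}" if HK: "H \<in> \<H>" "K \<in> \<H>" for H K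
  proof -
    consider "H = X" | "K = X" | "cut x (n + 1) H" "cut x (n + 1) K" | "cut y (m + 1) H" "cut y (m + 1) K"
      | "cut x (n + 1) H" "cut y (m + 1) K" | "cut y (m + 1) H" "cut x (n + 1) K"
      using HK unfolding \<H>_def by blast
    then show ?thesis
    proof cases
      case 1
      then show ?thesis using touch[OF HK(2)] x y by blast
    next
      case 2
      then show ?thesis using touch[OF HK(1)] x y by blast
    qed (use centre cross in blast)+
  qed
  have near: "\<exists>h\<in>H. d x h \<le> d x y" if "H \<in> \<H>" for H
    using touch[OF that] x mdist_zero[OF x] nonneg[of x y] by (metis order_refl)
  have ne: "\<H> \<noteq> {}" by (simp add: \<H>_def)
  obtain z where z: "z \<in> X"
    "\<And>U H. U \<in> \<SS> \<Longrightarrow> H \<in> \<H> \<Longrightarrow> \<exists>q\<in>hull_at U H. dC U (\<pi> U z) q \<le> Helly_constant"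
    using coarse_Helly[OF sub ne meet x near] by blast
  have "separation x z \<le> n + 1"
    using z(2) by (intro separation_le_of_cuts x z(1)) (auto simp: \<H>_def)
  moreover have "separation y z \<le> m + 1"
    using z(2) by (intro separation_le_of_cuts y z(1)) (auto simp: \<H>_def)
  ultimately show thesis using that z(1) by blast
qed

section \<open>Comparison of the separation number with \<open>d\<close>\<close>

lemma separated_of_domain:
  assumes V: "V \<in> \<SS>" and xy: "x \<in> X" "y \<in> X" and n: "real n * thickness \<le> dist_at V x y"
  shows "separated n x y"
proof (cases n)
  case (Suc k)
  interpret V: Metric_space "C V" "dC V" using metric_domain V .
  let ?p = "\<pi> V x" and ?q = "\<pi> V y"
  let ?A = "\<lambda>i. {z \<in> X. gp V ?p (\<pi> V z) ?q \<le> real i * thickness}"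
  let ?B = "\<lambda>i. {z \<in> X. real i * thickness + thickness \<le> gp V ?p (\<pi> V z) ?q}"
  have M: "?p \<in> C V" "?q \<in> C V" using \<pi>_in V xy by auto
  have wall: "wall (?A i) (?B i)" for i
    using V M unfolding wall_def by blast
  have "front x (Suc i) (?B i)" for i
  proof (induction i)
    case 0
    have "x \<in> ?A 0" using xy M by (simp add: gromov_product_def)
    then show ?case using front_first[OF wall] by blast
  next
    case (Suc i)
    \<comment> \<open>Consecutive walls share the level \<open>real (Suc i) * thickness\<close>, so
      these two sides leave no gap.\<close>
    have "X \<subseteq> ?B i \<union> ?A (Suc i)" by (auto simp: algebra_simps)
    then show ?case using front_next[OF Suc wall] by blast
  qed
  moreover have "y \<in> ?B k"
    using n Suc xy M by (simp add: gromov_product_def algebra_simps)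
  ultimately show ?thesis
    using Suc unfolding separated_def by blast
qed (simp add: separated_def)

lemma separation_proper:
  obtains \<theta> where "0 < \<theta>" "\<And>x y. x \<in> X \<Longrightarrow> y \<in> X \<Longrightarrow> separation x y \<le> k \<Longrightarrow> d x y \<le> \<theta>"
proof -
  have "0 \<le> real (Suc k) * thickness" using thickness_greater(1) by simp
  then obtain \<theta> where \<theta>: "\<forall>x\<in>X. \<forall>y\<in>X. d x y \<ge> \<theta> \<longrightarrow> (\<exists>V\<in>\<SS>. dist_at V x y \<ge> real (Suc k) * thickness)"
    using uniqueness by blast
  have "d x y \<le> max \<theta> 1" if xy: "x \<in> X" "y \<in> X" "separation x y \<le> k" for x y
  proof (rule ccontr)
    assume "\<not> ?thesis"
    then obtain V where "V \<in> \<SS>" "real (Suc k) * thickness \<le> dist_at V x y"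
      using \<theta> xy(1,2) by force
    then have "separated (Suc k) x y" using separated_of_domain xy(1,2) by blast
    then show False using separated_iff[OF xy(1,2)] xy(3) by simp
  qed
  with that[of "max \<theta> 1"] show thesis by auto
qed

text \<open>Pieces of separation at most 3 are peeled off, each of \<open>d\<close>-length at most
  \<open>\<theta>\<close>. Interpolation loses 1 at both ends, so 2 is the least split for which the
  rest decreases.\<close>

lemma dist_le_separation:
  obtains \<theta> where "0 < \<theta>" "\<And>x y. x \<in> X \<Longrightarrow> y \<in> X \<Longrightarrow> d x y \<le> \<theta> * (real (separation x y) + 1)"
proof -
  obtain \<theta> where \<theta>: "0 < \<theta>" "\<And>x y. x \<in> X \<Longrightarrow> y \<in> X \<Longrightarrow> separation x y \<le> 3 \<Longrightarrow> d x y \<le> \<theta>"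
    using separation_proper[of 3] by blast
  have "d x y \<le> \<theta> * (real (separation x y) + 1)" if "x \<in> X" "y \<in> X" for x y
    using that
  proof (induction "separation x y" arbitrary: x rule: less_induct)
    case less
    show ?case
    proof (cases "separation x y \<le> 3")
      case True
      then show ?thesis
        using \<theta>(2)[OF less(2,3) True] \<theta>(1) mult_nonneg_nonneg[of \<theta> "real (separation x y)"]
        unfolding distrib_left by linarith
    next
      case False
      have "separation x y \<le> 2 + (separation x y - 2)" by linarith
      then obtain z where z: "z \<in> X" "separation x z \<le> 2 + 1" "separation y z \<le> (separation x y - 2) + 1"
        using rough_interpolation[OF less(2,3)] by blast
      have zy: "separation z y \<le> separation x y - 1"
        using z(3) False separation_commute[of y z] by linarith
      then have "d z y \<le> \<theta> * (real (separation z y) + 1)"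
        using less(1)[of z] z(1) less(3) False by simp
      also have "\<dots> \<le> \<theta> * real (separation x y)"
        using zy False \<theta>(1) by (intro mult_left_mono) auto
      finally have "d z y \<le> \<theta> * real (separation x y)" .
      moreover have "d x z \<le> \<theta>" using \<theta>(2)[OF less(2) z(1)] z(2) by simp
      ultimately show ?thesis
        using triangle[OF less(2) z(1) less(3)] by (simp add: algebra_simps)
    qed
  qed
  with that \<theta>(1) show thesis by blast
qed

section \<open>The injective metric\<close>

text \<open>The added 1 absorbs the defect of the triangle inequality and distinguishes points that
  no wall separates.\<close>

definition sigma :: "'x \<Rightarrow> 'x \<Rightarrow> real" where
  "sigma x y = (if x \<in> X \<and> y \<in> X \<and> x \<noteq> y then real (separation x y) + 1 else 0)"

lemma separation_self: "x \<in> X \<Longrightarrow> separation x x = 0"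
  using separated_iff[of x x "separation x x"] not_separated_self by auto

lemma sigma_bounds:
  assumes "x \<in> X" "y \<in> X"
  shows "real (separation x y) \<le> sigma x y" "sigma x y \<le> real (separation x y) + 1"
  using assms separation_self by (auto simp: sigma_def)

lemma metric_sigma: "Metric_space X sigma"
proof
  show "0 \<le> sigma x y" for x y by (simp add: sigma_def)
  show "sigma x y = sigma y x" for x y
    using separation_commute[of x y] by (auto simp: sigma_def)
  show "sigma x y = 0 \<longleftrightarrow> x = y" if "x \<in> X" "y \<in> X" for x y
    using that by (auto simp: sigma_def)
  show "sigma x z \<le> sigma x y + sigma y z" if "x \<in> X" "y \<in> X" "z \<in> X" for x y z
    using separation_triangle[OF that] that by (auto simp: sigma_def)
qed

lemma quasi_isometry_sigma: "quasi_isometry X sigma X d id"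
proof -
  obtain \<theta> where \<theta>: "0 < \<theta>" "\<And>x y. x \<in> X \<Longrightarrow> y \<in> X \<Longrightarrow> d x y \<le> \<theta> * (real (separation x y) + 1)"
    using dist_le_separation by blast
  define K where "K = \<theta> + step + 1"
  have K: "1 \<le> K" "\<theta> \<le> K" "step + 1 \<le> K" using \<theta>(1) step(1) by (auto simp: K_def)
  have upper: "d x y \<le> K * sigma x y + K" if xy: "x \<in> X" "y \<in> X" for x y
  proof -
    have "d x y \<le> \<theta> * (real (separation x y) + 1)" using \<theta>(2) xy .
    also have "\<dots> \<le> K * (sigma x y + 1)"
      using K sigma_bounds[OF xy] \<theta>(1) by (intro mult_mono) auto
    finally show ?thesis by (simp add: algebra_simps)
  qed
  have lower: "sigma x y / K - K \<le> d x y" if xy: "x \<in> X" "y \<in> X" for x y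
  proof -
    have "separated (separation x y) x y" using separated_iff[OF xy] by simp
    then have "real (separation x y) \<le> step * d x y + step"
      using separated_bound[OF xy] by blast
    also have "\<dots> \<le> K * d x y + (K - 1)"
      using K by (intro add_mono mult_right_mono) auto
    finally have "sigma x y \<le> K * d x y + K"
      using sigma_bounds[OF xy] by linarith
    also have "\<dots> \<le> K * d x y + K * K"
      using K by simp
    finally show ?thesis
      using K by (simp add: field_simps)
  qed
  show ?thesis
    unfolding quasi_isometry_def quasi_isometric_embedding_def
  proof (intro exI[of _ K] conjI ballI)
    show "\<exists>x\<in>X. d (id x) y \<le> K" if "y \<in> X" for y
      using that K by (intro bexI[of _ y]) auto
  qed (use K upper lower in auto)
qed

text \<open>Helly is applied to enlarged balls: interpolation between two centres makes them meet in
  pairs, and each lies in all slightly longer cuts about its centre. Interpolation then leads from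
  the point found back into the original balls.\<close>

lemma coarsely_injective_sigma: "coarsely_injective X sigma"
  unfolding coarsely_injective_def
proof (intro conjI exI[of _ 7] allI impI)
  show "Metric_space X sigma" by (rule metric_sigma)
  interpret S: Metric_space X sigma by (rule metric_sigma)
  fix F :: "('x \<times> real) set"
  assume F: "F \<subseteq> X \<times> UNIV" and pair: "\<forall>(x, r)\<in>F. \<forall>(y, s)\<in>F. sigma x y \<le> r + s"
  show "X \<inter> (\<Inter>(x, r)\<in>F. neighbourhood X sigma 7 (S.mcball x r)) \<noteq> {}"
  proof (cases "F = {}")
    case True
    then show ?thesis using X_nonempty by simp
  next
    case False
    then obtain x0 r0 where 0: "(x0, r0) \<in> F" by auto
    have FX: "x \<in> X" if "(x, r) \<in> F" for x r using F that by auto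
    have r_nonneg: "0 \<le> r" if "(x, r) \<in> F" for x r
      using pair that FX[OF that] by fastforce
    let ?n = "\<lambda>r::real. nat \<lfloor>r\<rfloor>"
    define ball where "ball x r = {y \<in> X. separation x y \<le> ?n r + 2}" for x r
    \<comment> \<open>Fractional parts of the radii cost 1, charged to \<open>r\<close>;
      interpolation adds 1 on each side.\<close>
    have common: "\<exists>z\<in>X. separation x z \<le> ?n r + 2 \<and> separation y z \<le> ?n s + 1"
      if xr: "(x, r) \<in> F" and ys: "(y, s) \<in> F" for x r y s
    proof -
      have "sigma x y \<le> r + s" using pair xr ys by blast
      then have "real (separation x y) \<le> r + s"
        using sigma_bounds(1)[OF FX[OF xr] FX[OF ys]] by linarith
      also have "\<dots> < (real (?n r) + 1) + (real (?n s) + 1)"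
        using r_nonneg[OF xr] r_nonneg[OF ys] by (intro add_strict_mono) (simp_all add: of_nat_nat)
      finally have "real (separation x y) < real (?n r + ?n s + 2)" by simp
      then have "separation x y \<le> (?n r + 1) + ?n s"
        unfolding of_nat_less_iff by linarith
      then obtain z where "z \<in> X" "separation x z \<le> ?n r + 1 + 1" "separation y z \<le> ?n s + 1"
        using rough_interpolation[OF FX[OF xr] FX[OF ys]] by blast
      then show ?thesis by auto
    qed
    \<comment> \<open>All enlarged balls, however large their radii, meet one bounded set around
      \<open>x0\<close>.\<close>
    obtain \<theta> where \<theta>: "0 < \<theta>" "\<And>x y. x \<in> X \<Longrightarrow> y \<in> X \<Longrightarrow> separation x y \<le> ?n r0 + 2 \<Longrightarrow> d x y \<le> \<theta>"
      using separation_proper[of "?n r0 + 2"] by blast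
    define \<H> where "\<H> = (\<lambda>(x, r). ball x r) ` F"
    have "\<exists>z\<in>X. \<forall>U\<in>\<SS>. \<forall>H\<in>\<H>. \<exists>q\<in>hull_at U H. dC U (\<pi> U z) q \<le> Helly_constant"
    proof (rule coarse_Helly[of \<H> x0 \<theta>])
      show "H \<subseteq> X" if "H \<in> \<H>" for H using that by (auto simp: \<H>_def ball_def)
      show "\<H> \<noteq> {}" using False by (simp add: \<H>_def)
      show "H \<inter> K \<noteq> {}" if HK: "H \<in> \<H>" "K \<in> \<H>" for H K
      proof -
        obtain x r y s where xr: "(x, r) \<in> F" "H = ball x r" and ys: "(y, s) \<in> F" "K = ball y s"
          using HK by (auto simp: \<H>_def)
        obtain z where "z \<in> X" "separation x z \<le> ?n r + 2" "separation y z \<le> ?n s + 1"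
          using common[OF xr(1) ys(1)] by blast
        then have "z \<in> H \<inter> K" using xr ys by (auto simp: ball_def)
        then show ?thesis by blast
      qed
      show "x0 \<in> X" using FX 0 .
      show "\<exists>h\<in>H. d x0 h \<le> \<theta>" if H: "H \<in> \<H>" for H
      proof -
        obtain x r where xr: "(x, r) \<in> F" "H = ball x r" using H by (auto simp: \<H>_def)
        obtain z where "z \<in> X" "separation x0 z \<le> ?n r0 + 2" "separation x z \<le> ?n r + 1"
          using common[OF 0 xr(1)] by blast
        then show ?thesis
          using \<theta>(2)[OF FX[OF 0]] xr(2) by (intro bexI[of _ z]) (auto simp: ball_def)
      qed
    qed blast
    then obtain z where z: "z \<in> X"
      "\<And>U H. U \<in> \<SS> \<Longrightarrow> H \<in> \<H> \<Longrightarrow> \<exists>q\<in>hull_at U H. dC U (\<pi> U z) q \<le> Helly_constant"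
      by blast
    have "z \<in> neighbourhood X sigma 7 (S.mcball x r)" if xr: "(x, r) \<in> F" for x r
    proof -
      note xX = FX[OF xr]
      have "separation x z \<le> ?n r + 3"
      proof (rule separation_le_of_cuts[OF xX z(1)])
        fix A assume A: "cut x (?n r + 3) A"
        have "ball x r \<subseteq> A"
          using cut_contains[OF A] separated_iff[OF xX] by (auto simp: ball_def)
        moreover have "ball x r \<in> \<H>" using xr by (force simp: \<H>_def)
        ultimately show "\<exists>H\<subseteq>A. \<forall>U\<in>\<SS>. \<exists>q\<in>hull_at U H. dC U (\<pi> U z) q \<le> Helly_constant"
          using z(2) by blast
      qed simp
      then have xz: "separation x z \<le> ?n r + 3" .
      have "\<exists>y\<in>X. sigma x y \<le> r \<and> sigma y z \<le> 7"
      proof (cases "?n r < 2")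
        case True
        then have "sigma x z \<le> 7" using sigma_bounds(2)[OF xX z(1)] xz by linarith
        then show ?thesis
          using xX r_nonneg[OF xr] by (intro bexI[of _ x]) auto
      next
        case False
        \<comment> \<open>Giving up 2 of the radius pays for the error of interpolation and the 1 in
          \<open>sigma\<close>; the same two losses turn \<open>3 + 2\<close> into 7.\<close>
        then have "separation x z \<le> (?n r - 2) + 5" using xz by linarith
        then obtain y where y: "y \<in> X" "separation x y \<le> (?n r - 2) + 1" "separation z y \<le> 5 + 1"
          using rough_interpolation[OF xX z(1)] by blast
        have "sigma x y \<le> real (?n r)"
          using sigma_bounds(2)[OF xX y(1)] y(2) False by linarith
        also have "\<dots> \<le> r" using r_nonneg[OF xr] by simp
        finally have "sigma x y \<le> r" .
        moreover have "sigma z y \<le> 7"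
          using sigma_bounds(2)[OF z(1) y(1)] y(3) by linarith
        ultimately show ?thesis using y(1) S.commute by metis
      qed
      then show ?thesis using xX z(1) by (auto simp: neighbourhood_def)
    qed
    then show ?thesis using z(1) by blast
  qed
qed simp

text \<open>Walls go to walls both ways: each \<open>gC U\<close> preserves Gromov products, and
  surjectivity of \<open>gS\<close> and \<open>gC U\<close> lets every wall be pulled back. Chains
  follow.\<close>

lemma automorphism_sigma:
  assumes aut: "hhs_automorphism X d \<SS> C dC \<pi> nest orth \<rho> g gS gC" and xy: "x \<in> X" "y \<in> X"
  shows "sigma (g x) (g y) = sigma x y"
proof -
  have g: "g ` X = X" "\<And>x y. x \<in> X \<Longrightarrow> y \<in> X \<Longrightarrow> d (g x) (g y) = d x y"
    and gS: "gS ` \<SS> = \<SS>" and gC: "\<And>U. U \<in> \<SS> \<Longrightarrow> gC U ` C U = C (gS U)"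
      "\<And>U p q. U \<in> \<SS> \<Longrightarrow> p \<in> C U \<Longrightarrow> q \<in> C U \<Longrightarrow> dC (gS U) (gC U p) (gC U q) = dC U p q"
    and eq: "\<And>U x. U \<in> \<SS> \<Longrightarrow> x \<in> X \<Longrightarrow> gC U (\<pi> U x) = \<pi> (gS U) (g x)"
    using aut by (auto simp: hhs_automorphism_def isometry_onto_def bij_betw_def)
  have gp_eq: "gp (gS U) (gC U p) (\<pi> (gS U) (g z)) (gC U q) = gp U p (\<pi> U z) q"
    if "U \<in> \<SS>" "p \<in> C U" "q \<in> C U" "z \<in> X" for U p q z
    using that gC(2)[of U p q] gC(2)[of U p "\<pi> U z"] gC(2)[of U "\<pi> U z" q] \<pi>_in[of U z] eq[of U z]
    by (simp add: gromov_product_def)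
  have gX: "g z \<in> X" if "z \<in> X" for z using g(1) that by blast
  have push: "wall (g ` A) (g ` B)" if wAB: "wall A B" for A B
  proof -
    obtain U p q t where w: "U \<in> \<SS>" "p \<in> C U" "q \<in> C U" "A = {z \<in> X. gp U p (\<pi> U z) q \<le> t}"
      "B = {z \<in> X. t + thickness \<le> gp U p (\<pi> U z) q}"
      using wallE[OF wAB] .
    let ?U = "gS U" and ?p = "gC U p" and ?q = "gC U q"
    have img: "g ` {z \<in> X. P (gp U p (\<pi> U z) q)} = {z \<in> X. P (gp ?U ?p (\<pi> ?U z) ?q)}" for P
    proof -
      have "g ` {z \<in> X. P (gp ?U ?p (\<pi> ?U (g z)) ?q)} = {z \<in> g ` X. P (gp ?U ?p (\<pi> ?U z) ?q)}"
        by auto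
      moreover have "{z \<in> X. P (gp ?U ?p (\<pi> ?U (g z)) ?q)} = {z \<in> X. P (gp U p (\<pi> U z) q)}"
        using gp_eq[OF w(1-3)] by auto
      ultimately show ?thesis using g(1) by simp
    qed
    have "?U \<in> \<SS>" "?p \<in> C ?U" "?q \<in> C ?U" using gS gC(1) w(1-3) by blast+
    moreover have "g ` A = {z \<in> X. gp ?U ?p (\<pi> ?U z) ?q \<le> t}"
      unfolding w(4) by (rule img)
    moreover have "g ` B = {z \<in> X. t + thickness \<le> gp ?U ?p (\<pi> ?U z) ?q}"
      unfolding w(5) by (rule img)
    ultimately show ?thesis unfolding wall_def by blast
  qed
  have pull: "wall {z \<in> X. g z \<in> A} {z \<in> X. g z \<in> B}" if wAB: "wall A B" for A B
  proof -
    obtain U' p' q' t where w: "U' \<in> \<SS>" "p' \<in> C U'" "q' \<in> C U'" "A = {z \<in> X. gp U' p' (\<pi> U' z) q' \<le> t}"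
      "B = {z \<in> X. t + thickness \<le> gp U' p' (\<pi> U' z) q'}"
      using wallE[OF wAB] .
    obtain U where U: "U \<in> \<SS>" "U' = gS U" using w(1) gS by blast
    obtain p where p: "p \<in> C U" "p' = gC U p" using w(2) gC(1)[OF U(1)] U(2) by blast
    obtain q where q: "q \<in> C U" "q' = gC U q" using w(3) gC(1)[OF U(1)] U(2) by blast
    have "{z \<in> X. g z \<in> A} = {z \<in> X. gp U p (\<pi> U z) q \<le> t}"
      "{z \<in> X. g z \<in> B} = {z \<in> X. t + thickness \<le> gp U p (\<pi> U z) q}"
      unfolding w(4,5) U(2) p(2) q(2) using gp_eq[OF U(1) p(1) q(1)] gX by auto
    then show ?thesis
      using U(1) p(1) q(1) unfolding wall_def by blast
  qed
  have front_push: "front (g x) n (g ` B)" if "front x n B" for n B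
    using that
  proof (induction rule: front.induct)
    case (front_first A B)
    then show ?case using front.front_first[OF push] by blast
  next
    case (front_next n B A' B')
    then have "X \<subseteq> g ` B \<union> g ` A'" using g(1) by blast
    then show ?case using front.front_next[OF front_next(4) push[OF front_next(2)]] by blast
  qed
  have front_pull: "front x n {z \<in> X. g z \<in> B}" if "front (g x) n B" for n B
    using that
  proof (induction rule: front.induct)
    case (front_first A B)
    then show ?case using front.front_first[OF pull[OF front_first(1)], of x] xy by blast
  next
    case (front_next n B A' B')
    then have "X \<subseteq> {z \<in> X. g z \<in> B} \<union> {z \<in> X. g z \<in> A'}" using gX by blast
    then show ?case using front.front_next[OF front_next(4) pull[OF front_next(2)]] by blast
  qed
  have "separated n (g x) (g y) \<longleftrightarrow> separated n x y" for n
    using front_push front_pull xy unfolding separated_def by blast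
  then have "separation (g x) (g y) = separation x y"
    by (simp add: separation_def)
  moreover have "g x = g y \<longleftrightarrow> x = y"
    using g(2)[OF xy] zero[of x y] zero[of "g x" "g y"] xy gX by auto
  ultimately show ?thesis
    using xy gX by (simp add: sigma_def)
qed

end

theorem theoremA:
  fixes X :: "'x set" and d :: "'x \<Rightarrow> 'x \<Rightarrow> real" and E :: real
    and \<SS> :: "'u set" and C :: "'u \<Rightarrow> 'c set" and dC :: "'u \<Rightarrow> 'c \<Rightarrow> 'c \<Rightarrow> real"
    and \<pi> :: "'u \<Rightarrow> 'x \<Rightarrow> 'c" and nest orth :: "'u rel"
    and \<rho> :: "'u \<Rightarrow> 'u \<Rightarrow> 'c set" and \<rho>map :: "'u \<Rightarrow> 'u \<Rightarrow> 'c \<Rightarrow> 'c"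
  assumes "hierarchically_hyperbolic_space X d E \<SS> C dC \<pi> nest orth \<rho> \<rho>map"
  shows "\<exists>\<sigma>. Metric_space X \<sigma> \<and> coarsely_injective X \<sigma> \<and> quasi_isometry X \<sigma> X d id \<and>
    (\<forall>g gS gC. hhs_automorphism X d \<SS> C dC \<pi> nest orth \<rho> g gS gC \<longrightarrow>
      (\<forall>x\<in>X. \<forall>y\<in>X. \<sigma> (g x) (g y) = \<sigma> x y))"
proof -
  interpret hierarchically_hyperbolic_space X d E \<SS> C dC \<pi> nest orth \<rho> \<rho>map by fact
  show ?thesis
    using metric_sigma coarsely_injective_sigma quasi_isometry_sigma automorphism_sigma by blast
qed

end
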